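(* Let $\mathcal{A}:\mathcal{S}^k\to\mathbb{R}^l$ be the linear operator $\mathcal{A}(X)=[\langle A_1,X\rangle,\dots,\langle A_l,X\rangle]^T$ with $A_1,\dots,A_l\in\mathcal{S}^k$, let $b\in\mathbb{R}^l$, $B\in\mathbb{R}^{k\times m}$, and let $$\mathcal{F}_p=\{X\in\mathcal{S}^k:\ \mathcal{A}(X)=b,\ B^TX=0,\ X\succeq 0\}.$$ Then the facial reduction algorithm (described in the context) with input $(\mathcal{A},b,B)$ returns a maximum rank solution of $\mathcal{F}_p$, i.e. a matrix $X\in\mathcal{F}_p$ whose rank is maximal among all elements of $\mathcal{F}_p$.
   Context: $\mathcal{S}^k$ is the space of real symmetric $k\times k$ matrices, $\langle A,B\rangle=\operatorname{trace}(A^TB)$; $\succeq 0$ and $\succ 0$ mean positive semidefinite and positive definite. Facial reduction algorithm (exact arithmetic). Input: $A_1,\dots,A_l$ (defining $\mathcal{A}$), $b$, $B$. Initialize $j=1$, $U=I_k$. Repeat: - If $j=1$, set $Z=BB^T$. If $j>1$, find a nonzero $Z\succeq 0$ such that $Z=\sum_{i=1}^l A_iy_i$ for some $y\in\mathbb{R}^l$ with $b^Ty=0$ (auxiliary problem, with the current $A_i$). - Find a matrix $V$ whose columns form a basis of the null space of $Z$. - Update $A_i\leftarrow V^TA_iV$ for $i=1,\dots,l$ (and $\mathcal{A}$ accordingly). - Update $U\leftarrow UV$, and $j\leftarrow j+1$. Until the auxiliary problem (with the current $A_i$) has only the zero solution $Z=0$. Then solve $\mathcal{A}(P)=b$, $P\succ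 0$ (with the current $\mathcal{A}$), and return $X:=UPU^T$.
   Formalization: That the algorithm actually returns a matrix is claimed under the assumption that F_p is non-empty (otherwise no solution exists to return); termination, and that anything returned is a maximum rank solution, hold without it. *)

theory Defs
  imports Complex_Main "Jordan_Normal_Form.DL_Rank" "Jordan_Normal_Form.Matrix_Kernel"
begin

definition sym_mats :: "nat \<Rightarrow> real mat set" where
  "sym_mats n = {M \<in> carrier_mat n n. transpose_mat M = M}"

definition psd_mats :: "nat \<Rightarrow> real mat set" where
  "psd_mats n = {M \<in> sym_mats n. \<forall>v \<in> carrier_vec n. 0 \<le> v \<bullet> (M *\<^sub>v v)}"

definition pd_mats :: "nat \<Rightarrow> real mat set" where
  "pd_mats n = {M \<in> sym_mats n. \<forall>v \<in> carrier_vec n. v \<noteq> 0\<^sub>v n \<longrightarrow> 0 < v \<bullet> (M *\<^sub>v v)}"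

definition mat_trace :: "real mat \<Rightarrow> real" where
  "mat_trace M = sum_list (diag_mat M)"

definition mat_inner :: "real mat \<Rightarrow> real mat \<Rightarrow> real" where
  "mat_inner M N = mat_trace (transpose_mat M * N)"

text \<open>The list \<open>As\<close> holds the matrices \<open>A\<^sub>1, \<dots>, A\<^sub>l\<close>; the index \<open>i\<close> runs over \<open>i < length As\<close>.\<close>

definition lin_op :: "real mat list \<Rightarrow> real mat \<Rightarrow> real vec" where
  "lin_op As X = vec (length As) (\<lambda>i. mat_inner (As ! i) X)"

definition mat_lincomb :: "nat \<Rightarrow> real mat list \<Rightarrow> real vec \<Rightarrow> real mat" where
  "mat_lincomb n As y = mat n n (\<lambda>(r, c). \<Sum>i<length As. (As ! i) $$ (r, c) * y $ i)"

definition feasible_set :: "nat \<Rightarrow> real mat list \<Rightarrow> real vec \<Rightarrow> real mat \<Rightarrow> real mat set" where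
  "feasible_set k As b B =
     {X \<in> psd_mats k. lin_op As X = b \<and> transpose_mat B * X = 0\<^sub>m (dim_col B) k}"

definition max_rank_solution :: "nat \<Rightarrow> real mat list \<Rightarrow> real vec \<Rightarrow> real mat \<Rightarrow> real mat \<Rightarrow> bool" where
  "max_rank_solution k As b B X \<longleftrightarrow>
     X \<in> feasible_set k As b B \<and>
     (\<forall>Y \<in> feasible_set k As b B. vec_space.rank k Y \<le> vec_space.rank k X)"

text \<open>Solutions of the auxiliary problem, the zero matrix included; \<open>n\<close> is the current order of
  the matrices in \<open>As\<close>.\<close>

definition aux_solutions :: "nat \<Rightarrow> real mat list \<Rightarrow> real vec \<Rightarrow> real mat set" where
  "aux_solutions n As b =
     {Z \<in> psd_mats n. \<exists>y \<in> carrier_vec (length As). b \<bullet> y = 0 \<and> Z = mat_lincomb n As y}"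

text \<open>Distinctness is required because \<open>set (cols V)\<close> forgets repeated columns. If the null space
  is zero, then \<open>V\<close> is the matrix with \<open>n\<close> rows and no columns.\<close>

definition null_space_basis :: "nat \<Rightarrow> real mat \<Rightarrow> real mat \<Rightarrow> bool" where
  "null_space_basis n Z V \<longleftrightarrow>
     dim_row V = n \<and> distinct (cols V) \<and> kernel.basis n Z (set (cols V))"

text \<open>A state \<open>(j, As, U)\<close> holds the current values of the program variables. The current order of
  the matrices in \<open>As\<close> is \<open>dim_col U\<close>. Since \<open>Z\<close> and \<open>V\<close> are arbitrary choices, the loop body is a
  relation between states.\<close>

type_synonym fra_state = "nat \<times> real mat list \<times> real mat"

definition fra_init :: "nat \<Rightarrow> real mat list \<Rightarrow> fra_state" where
  "fra_init k As = (1, As, 1\<^sub>m k)"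

definition fra_choice :: "real vec \<Rightarrow> real mat \<Rightarrow> fra_state \<Rightarrow> real mat \<Rightarrow> bool" where
  "fra_choice b B = (\<lambda>(j, As, U) Z.
     if j = 1 then Z = B * transpose_mat B
     else Z \<in> aux_solutions (dim_col U) As b \<and> Z \<noteq> 0\<^sub>m (dim_col U) (dim_col U))"

definition fra_step :: "real vec \<Rightarrow> real mat \<Rightarrow> fra_state \<Rightarrow> fra_state \<Rightarrow> bool" where
  "fra_step b B = (\<lambda>(j, As, U) s'. \<exists>Z V.
     fra_choice b B (j, As, U) Z \<and>
     null_space_basis (dim_col U) Z V \<and>
     s' = (j + 1, map (\<lambda>M. transpose_mat V * M * V) As, U * V))"

text \<open>The exit test is evaluated only after the loop body, hence \<open>j > 1\<close>. A state that passes it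
  has no successor under \<open>fra_step\<close>, as a further step needs a nonzero \<open>Z\<close>.\<close>

definition fra_exit :: "real vec \<Rightarrow> fra_state \<Rightarrow> bool" where
  "fra_exit b = (\<lambda>(j, As, U).
     j > 1 \<and> (\<forall>Z \<in> aux_solutions (dim_col U) As b. Z = 0\<^sub>m (dim_col U) (dim_col U)))"

definition fra_reachable :: "nat \<Rightarrow> real mat list \<Rightarrow> real vec \<Rightarrow> real mat \<Rightarrow> fra_state \<Rightarrow> bool" where
  "fra_reachable k As b B s \<longleftrightarrow> (fra_step b B)\<^sup>*\<^sup>* (fra_init k As) s"

definition fra_returns :: "real vec \<Rightarrow> fra_state \<Rightarrow> real mat \<Rightarrow> bool" where
  "fra_returns b = (\<lambda>(j, As, U) X. fra_exit b (j, As, U) \<and>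
     (\<exists>P \<in> pd_mats (dim_col U). lin_op As P = b \<and> X = U * P * transpose_mat U))"

end

theory Submission
  imports Defs "HOL-Analysis.Function_Topology"
begin

text \<open>
  Every feasible \<open>X\<close> has the form \<open>U P U\<^sup>T\<close> with \<open>P \<succeq> 0\<close> for the current \<open>U\<close>: the chosen \<open>Z \<succeq> 0\<close> is
  orthogonal to \<open>P\<close>, hence \<open>Z P = 0\<close> and \<open>P\<close> lives on the null space of \<open>Z\<close>. A nonzero \<open>Z\<close> lowers the
  order, so the loop stops. If the auxiliary problem has only the zero solution, then the subspace of
  all \<open>\<Sum>\<^sub>i y\<^sub>i A\<^sub>i\<close> with \<open>b \<bullet> y = 0\<close> misses the compact convex base of the positive semidefinite cone,
  and separating the two yields a positive definite \<open>P\<close> with \<open>\<A>(P) = b\<close>. As \<open>U\<close> is injective and \<open>P\<close> is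
  invertible, each feasible \<open>Y = U Q U\<^sup>T\<close> is a right multiple of \<open>X = U P U\<^sup>T\<close>, so its rank is no larger.

  The order of the matrices changes during the run, so they cannot live in a fixed Euclidean space
  type. The separation argument therefore uses functions on a finite index set.
\<close>

section \<open>Separation of a compact convex set from a subspace\<close>

definition idot :: "'i set \<Rightarrow> ('i \<Rightarrow> real) \<Rightarrow> ('i \<Rightarrow> real) \<Rightarrow> real" where
  "idot I f g = (\<Sum>i\<in>I. f i * g i)"

lemma idot_commute: "idot I f g = idot I g f"
  unfolding idot_def by (simp add: mult.commute)

lemma idot_add: "idot I (\<lambda>i. f i + g i) h = idot I f h + idot I g h"
  unfolding idot_def by (simp add: algebra_simps sum.distrib)

lemma idot_diff: "idot I (\<lambda>i. f i - g i) h = idot I f h - idot I g h"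
  unfolding idot_def by (simp add: algebra_simps sum_subtractf)

lemma idot_scale: "idot I (\<lambda>i. c * f i) h = c * idot I f h"
  unfolding idot_def by (simp add: sum_distrib_left mult.assoc)

lemma idot_sum: "idot I (\<lambda>i. \<Sum>j\<in>J. y j * W j i) h = (\<Sum>j\<in>J. y j * idot I (W j) h)"
  unfolding idot_def sum_distrib_right sum_distrib_left
  by (subst sum.swap) (simp add: mult.assoc)

lemma idot_self_nonneg: "0 \<le> idot I f f"
  unfolding idot_def by (rule sum_nonneg) auto

lemma idot_self_eq_0: "finite I \<Longrightarrow> idot I f f = 0 \<longleftrightarrow> (\<forall>i\<in>I. f i = 0)"
  unfolding idot_def by (subst sum_nonneg_eq_0_iff) auto

lemma ex_orthogonal_projection:
  fixes W :: "nat \<Rightarrow> 'i \<Rightarrow> real"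
  assumes "finite I"
  shows "\<exists>c. \<forall>z. \<forall>k<l. idot I (\<lambda>i. z i - (\<Sum>j<l. idot I (c j) z * W j i)) (W k) = 0"
proof (induction l)
  case 0
  then show ?case by simp
next
  case (Suc l)
  then obtain c where c: "\<And>z k. k < l \<Longrightarrow>
      idot I (\<lambda>i. z i - (\<Sum>j<l. idot I (c j) z * W j i)) (W k) = 0"
    by blast
  define r where "r z = (\<lambda>i. z i - (\<Sum>j<l. idot I (c j) z * W j i))" for z
  have r: "idot I (r z) (W k) = 0" if "k < l" for z k
    unfolding r_def by (rule c[OF that])
  have r_sum: "idot I (r z) (\<lambda>i. \<Sum>j<l. y j * W j i) = 0" for z y
    by (subst idot_commute, subst idot_sum) (simp add: idot_commute[of I "W _"] r)
  define u where "u = r (W l)"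
  define \<alpha> where "\<alpha> = inverse (idot I u u)"
  define c' where "c' j = (if j < l then (\<lambda>i. c j i - (\<alpha> * idot I (c j) (W l)) * u i)
    else (\<lambda>i. \<alpha> * u i))" for j
  have W: "W l = (\<lambda>i. u i + (\<Sum>j<l. idot I (c j) (W l) * W j i))"
    by (simp add: u_def r_def)
  have r': "z i - (\<Sum>j<Suc l. idot I (c' j) z * W j i) = r z i - \<alpha> * idot I u z * u i" for z i
  proof -
    have c'_z: "idot I (c' j) z = idot I (c j) z - (\<alpha> * idot I (c j) (W l)) * idot I u z" if "j < l" for j
      unfolding c'_def using that by (simp only: if_True idot_diff idot_scale)
    have "(\<Sum>j<l. idot I (c' j) z * W j i)
        = (\<Sum>j<l. idot I (c j) z * W j i)
          - \<alpha> * idot I u z * (\<Sum>j<l. idot I (c j) (W l) * W j i)"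
      unfolding sum_distrib_left sum_subtractf[symmetric]
      by (rule sum.cong) (auto simp: c'_z algebra_simps)
    moreover have "idot I (c' l) z = \<alpha> * idot I u z"
      by (simp add: c'_def idot_scale)
    moreover have u_i: "u i = W l i - (\<Sum>j<l. idot I (c j) (W l) * W j i)"
      by (simp add: u_def r_def)
    ultimately show ?thesis
      unfolding u_i r_def sum.lessThan_Suc by (simp only:) (simp add: algebra_simps)
  qed
  have "idot I (\<lambda>i. z i - (\<Sum>j<Suc l. idot I (c' j) z * W j i)) (W k) = 0" if k: "k < Suc l" for z k
  proof -
    have eq: "idot I (\<lambda>i. z i - (\<Sum>j<Suc l. idot I (c' j) z * W j i)) g
       = idot I (r z) g - \<alpha> * idot I u z * idot I u g" for g
      unfolding r' by (simp add: idot_diff idot_scale)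
    show ?thesis
    proof (cases "k < l")
      case True
      then show ?thesis unfolding eq by (simp add: r u_def)
    next
      case False
      with k have kl: "k = l" by simp
      have 1: "idot I (r x) (W l) = idot I (r x) u" for x
        by (subst W, subst idot_commute, subst idot_add)
          (simp add: idot_commute[of I _ "r x"] r_sum)
      have 2: "idot I (r z) u = idot I z u"
        unfolding r_def idot_diff
        by (subst (2) idot_commute) (simp add: u_def r_sum)
      show ?thesis
      proof (cases "idot I u u = 0")
        case True
        with assms have "\<forall>i\<in>I. u i = 0" by (simp add: idot_self_eq_0)
        then have "idot I z u = 0" by (simp add: idot_def)
        with True show ?thesis unfolding eq kl 1 2 by (simp add: \<alpha>_def)
      next
        case False
        then show ?thesis
          unfolding eq kl 1 2 using 1[of "W l"] by (simp add: \<alpha>_def u_def[symmetric] idot_commute)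
      qed
    qed
  qed
  then show ?case by blast
qed

text \<open>The separating functional is the residual, orthogonal to the span, of the point of \<open>D\<close> nearest
  to the span.\<close>

lemma separation_compact_convex_span:
  fixes W :: "nat \<Rightarrow> 'i \<Rightarrow> real" and D :: "('i \<Rightarrow> real) set"
  assumes I: "finite I" and D: "compact D" "D \<noteq> {}"
    and conv: "\<And>x y t. x \<in> D \<Longrightarrow> y \<in> D \<Longrightarrow> 0 \<le> t \<Longrightarrow> t \<le> 1 \<Longrightarrow> (\<lambda>i. (1 - t) * x i + t * y i) \<in> D"
    and disj: "\<And>z y. z \<in> D \<Longrightarrow> \<exists>i\<in>I. z i \<noteq> (\<Sum>j<l. y j * W j i)"
  shows "\<exists>z\<in>D. \<exists>y. let p = (\<lambda>i. z i - (\<Sum>j<l. y j * W j i)) in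
    (\<forall>k<l. idot I p (W k) = 0) \<and> (\<forall>d\<in>D. 0 < idot I p d)"
proof -
  obtain c where c: "\<And>z k. k < l \<Longrightarrow>
      idot I (\<lambda>i. z i - (\<Sum>j<l. idot I (c j) z * W j i)) (W k) = 0"
    using ex_orthogonal_projection[OF I, of l W] by blast
  define r where "r z = (\<lambda>i. z i - (\<Sum>j<l. idot I (c j) z * W j i))" for z
  have r: "idot I (r z) (W k) = 0" if "k < l" for z k
    unfolding r_def by (rule c[OF that])
  have "continuous_on UNIV (\<lambda>z. z i :: real)" for i :: 'i
    by (rule continuous_on_product_coordinates)
  then have coord: "continuous_on D (\<lambda>z. z i :: real)" for i :: 'i
    by (rule continuous_on_subset) simp
  have "continuous_on D (\<lambda>z. idot I (r z) (r z))"
    unfolding idot_def r_def by (intro continuous_intros coord)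
  from continuous_attains_inf[OF D this] obtain z where z: "z \<in> D"
    and min: "\<And>x. x \<in> D \<Longrightarrow> idot I (r z) (r z) \<le> idot I (r x) (r x)"
    by blast
  have rz: "idot I (r z) (r z) > 0"
  proof -
    have "\<exists>i\<in>I. r z i \<noteq> 0"
      using disj[OF z, of "\<lambda>j. idot I (c j) z"] by (auto simp: r_def)
    with idot_self_eq_0[OF I, of "r z"] idot_self_nonneg[of I "r z"] show ?thesis by force
  qed
  have pos: "0 < idot I (r z) d" if d: "d \<in> D" for d
  proof -
    define q where "q = (\<lambda>i. r d i - r z i)"
    have rlin: "r (\<lambda>i. (1 - t) * z i + t * d i) = (\<lambda>i. r z i + t * q i)" for t
    proof
      fix i
      have "idot I (c j) (\<lambda>i. (1 - t) * z i + t * d i)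
        = (1 - t) * idot I (c j) z + t * idot I (c j) d" for j
        by (simp only: idot_commute[of I "c j"] idot_add idot_scale)
      then show "r (\<lambda>i. (1 - t) * z i + t * d i) i = r z i + t * q i"
        unfolding r_def[of "\<lambda>i. (1 - t) * z i + t * d i"]
        by (simp only:) (simp add: r_def q_def algebra_simps sum.distrib sum_subtractf sum_distrib_left)
    qed
    have quad: "0 \<le> 2 * t * idot I (r z) q + t\<^sup>2 * idot I q q" if "0 \<le> t" "t \<le> 1" for t
    proof -
      have "idot I (\<lambda>i. r z i + t * q i) (\<lambda>i. r z i + t * q i)
        = idot I (r z) (r z) + 2 * t * idot I (r z) q + t\<^sup>2 * idot I q q"
        unfolding idot_add idot_scale
        by (subst (1 2) idot_commute, unfold idot_add idot_scale)
          (simp add: idot_commute[of I q "r z"] algebra_simps power2_eq_square)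
      with min[OF conv[OF z d that]] show ?thesis unfolding rlin by simp
    qed
    have "0 \<le> idot I (r z) q"
    proof (rule ccontr)
      assume "\<not> ?thesis"
      then have neg: "idot I (r z) q < 0" by simp
      define t where "t = min 1 (- idot I (r z) q / (idot I q q + 1))"
      have qq: "idot I q q \<ge> 0" by (rule idot_self_nonneg)
      have t: "0 < t" "t \<le> 1" using neg qq by (auto simp: t_def intro!: divide_neg_pos)
      have "t \<le> - idot I (r z) q / (idot I q q + 1)" by (simp add: t_def)
      then have "t * (idot I q q + 1) \<le> - idot I (r z) q"
        using qq by (subst (asm) pos_le_divide_eq) auto
      then have "t * idot I q q < - idot I (r z) q" using t by (simp add: algebra_simps)
      then have "t * (t * idot I q q) < t * (- idot I (r z) q)"
        using t by (intro mult_strict_left_mono)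
      moreover have "t * idot I (r z) q < 0" using neg t by (simp add: mult_pos_neg)
      ultimately show False using quad[of t] t by (simp add: power2_eq_square mult.assoc)
    qed
    then have "idot I (r z) (r z) \<le> idot I (r z) (r d)"
      unfolding q_def by (subst (asm) idot_commute) (simp add: idot_diff idot_commute)
    also have "idot I (r z) (r d) = idot I (r z) d"
      unfolding r_def[of d]
      by (subst idot_commute, unfold idot_diff idot_sum)
        (simp add: idot_commute[of I _ "r z"] r)
    finally show ?thesis using rz by simp
  qed
  show ?thesis
    unfolding Let_def
    by (rule bexI[OF _ z], rule exI[of _ "\<lambda>j. idot I (c j) z"])
      (use pos r[of _ z] in \<open>auto simp: r_def\<close>)
qed

section \<open>Null space bases and rank\<close>

lemma scalar_prod_self_eq_0:
  fixes v :: "real vec"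
  assumes "v \<bullet> v = 0"
  shows "v = 0\<^sub>v (dim_vec v)"
proof -
  have "(\<Sum>i\<in>{0..<dim_vec v}. v $ i * v $ i) = 0"
    using assms by (simp add: scalar_prod_def)
  then have "\<forall>i\<in>{0..<dim_vec v}. v $ i * v $ i = 0"
    by (subst (asm) sum_nonneg_eq_0_iff) auto
  then show ?thesis by (intro eq_vecI) auto
qed

lemma kernel_transpose_mult_self:
  fixes M :: "real mat"
  assumes M: "M \<in> carrier_mat n r" and x: "x \<in> carrier_vec r"
    and 0: "(transpose_mat M * M) *\<^sub>v x = 0\<^sub>v r"
  shows "M *\<^sub>v x = 0\<^sub>v n"
proof -
  have "transpose_mat M *\<^sub>v (M *\<^sub>v x) = 0\<^sub>v r"
    using 0 M x by (subst (asm) assoc_mult_mat_vec[of _ r n]) auto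
  then have "(M *\<^sub>v x) \<bullet> (M *\<^sub>v x) = 0"
    using transpose_vec_mult_scalar[OF M x, of "M *\<^sub>v x"] M x by auto
  from scalar_prod_self_eq_0[OF this] M show ?thesis by auto
qed

lemma ex_left_inverse:
  fixes V :: "real mat"
  assumes V: "V \<in> carrier_mat n r"
    and inj: "\<And>x. x \<in> carrier_vec r \<Longrightarrow> V *\<^sub>v x = 0\<^sub>v n \<Longrightarrow> x = 0\<^sub>v r"
  shows "\<exists>L\<in>carrier_mat r n. L * V = 1\<^sub>m r"
proof -
  let ?G = "transpose_mat V * V"
  have G: "?G \<in> carrier_mat r r" using V by auto
  have "det ?G \<noteq> 0"
    using det_0_iff_vec_prod_zero_field[OF G] kernel_transpose_mult_self[OF V] inj by blast
  from det_non_zero_imp_unit[OF G this, of "()"] obtain H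
    where H: "H \<in> carrier_mat r r" "H * ?G = 1\<^sub>m r"
    unfolding Units_def ring_mat_def by auto
  have "H * transpose_mat V * V = 1\<^sub>m r"
    using H V by (subst assoc_mult_mat[of _ r r _ n _ r]) auto
  then show ?thesis using H V by (intro bexI[of _ "H * transpose_mat V"]) auto
qed

lemma left_inverse_mult_vec:
  fixes V :: "real mat"
  assumes "V \<in> carrier_mat n r" "L \<in> carrier_mat r n" "L * V = 1\<^sub>m r" "x \<in> carrier_vec r"
  shows "L *\<^sub>v (V *\<^sub>v x) = x"
  using assms assoc_mult_mat_vec[of L r n V r x] by simp

lemma null_space_basisD:
  assumes Z: "Z \<in> carrier_mat n n" and V: "null_space_basis n Z V"
  shows "V \<in> carrier_mat n (dim_col V)"
    and "Z * V = 0\<^sub>m n (dim_col V)"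
    and "\<And>x. x \<in> carrier_vec (dim_col V) \<Longrightarrow> V *\<^sub>v x = 0\<^sub>v n \<Longrightarrow> x = 0\<^sub>v (dim_col V)"
    and "\<And>v. v \<in> carrier_vec n \<Longrightarrow> Z *\<^sub>v v = 0\<^sub>v n \<Longrightarrow> \<exists>x\<in>carrier_vec (dim_col V). v = V *\<^sub>v x"
    and "dim_col V \<le> n"
proof -
  interpret kernel n n Z by unfold_locales (rule Z)
  from V have row: "dim_row V = n" and dist: "distinct (cols V)"
    and basis: "basis (set (cols V))"
    by (auto simp: null_space_basis_def)
  show carr: "V \<in> carrier_mat n (dim_col V)" using row by auto
  from basis have sub: "set (cols V) \<subseteq> mat_kernel Z"
    and indep: "\<not> Ker.lin_dep (set (cols V))"
    and span: "span (set (cols V)) = mat_kernel Z"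
    unfolding Ker.basis_def by auto
  have indep': "NC.lin_indpt (set (cols V))"
    using indep lindep_same[OF sub] by simp
  have colsc: "set (cols V) \<subseteq> carrier_vec n" using carr cols_dim by blast
  show "Z * V = 0\<^sub>m n (dim_col V)"
  proof (rule eq_matI)
    fix i j assume ij: "i < dim_row (0\<^sub>m n (dim_col V))" "j < dim_col (0\<^sub>m n (dim_col V) :: real mat)"
    then have "col V j \<in> set (cols V)" by (simp add: cols_def)
    with sub have "Z *\<^sub>v col V j = 0\<^sub>v n" using mat_kernelD(2)[OF Z] by blast
    then have "(Z *\<^sub>v col V j) $ i = 0" using ij by simp
    then show "(Z * V) $$ (i, j) = 0\<^sub>m n (dim_col V) $$ (i, j)" using ij Z row by simp
  qed (use Z in auto)
  show "x = 0\<^sub>v (dim_col V)" if "x \<in> carrier_vec (dim_col V)" "V *\<^sub>v x = 0\<^sub>v n" for x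
    using NC.lin_depI[OF carr that(1) _ that(2) dist] indep' by blast
  show "\<exists>x\<in>carrier_vec (dim_col V). v = V *\<^sub>v x"
    if "v \<in> carrier_vec n" "Z *\<^sub>v v = 0\<^sub>v n" for v
  proof -
    have "v \<in> NC.span (set (cols V))"
      using that span span_same[OF sub] mat_kernelI[OF Z] by blast
    then obtain a where "v = NC.lincomb a (set (cols V))"
      using NC.finite_span[OF finite_set colsc] by auto
    then show ?thesis
      using NC.mat_mult_eq_lincomb[OF carr dist, of a] by (metis vec_carrier)
  qed
  have "card (set (cols V)) \<le> NC.dim"
    using NC.li_le_dim(2)[OF NC.fin_dim colsc indep'] .
  then show "dim_col V \<le> n"
    using distinct_card[OF dist] NC.dim_is_n by simp
qed

lemma ex_null_space_basis:
  assumes Z: "Z \<in> carrier_mat n n"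
  shows "\<exists>V. null_space_basis n Z V"
proof -
  interpret kernel n n Z by unfold_locales (rule Z)
  from kernel_basis_exists[OF Z] obtain S where S: "finite S" "basis S" by auto
  then obtain xs where xs: "set xs = S" "distinct xs"
    using finite_distinct_list by blast
  have "S \<subseteq> carrier_vec n"
    using S mat_kernel_carrier[OF Z] unfolding Ker.basis_def by auto
  then have "cols (mat_of_cols n xs) = xs" using xs by (intro cols_mat_of_cols) auto
  then have "null_space_basis n Z (mat_of_cols n xs)"
    using xs S by (simp add: null_space_basis_def)
  then show ?thesis by blast
qed

lemma dim_col_null_space_basis_less:
  assumes Z: "Z \<in> carrier_mat n n" and V: "null_space_basis n Z V" and nz: "Z \<noteq> 0\<^sub>m n n"
  shows "dim_col V < n"
proof (rule ccontr)
  assume "\<not> ?thesis"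
  with null_space_basisD(5)[OF Z V] have n: "dim_col V = n" by simp
  note D = null_space_basisD(1-3)[OF Z V, unfolded n]
  obtain L where L: "L \<in> carrier_mat n n" "L * V = 1\<^sub>m n"
    using ex_left_inverse[OF D(1,3)] by blast
  have VL: "V * L = 1\<^sub>m n" using mat_mult_left_right_inverse[OF L(1) D(1) L(2)] .
  have "Z = Z * (V * L)" using Z VL by simp
  also have "\<dots> = Z * V * L" using Z D(1) L(1) by (simp add: assoc_mult_mat[of Z n n V n L n])
  also have "\<dots> = 0\<^sub>m n n" using D(2) L(1) by simp
  finally show False using nz by simp
qed

lemma rank_mult_le:
  assumes X: "X \<in> carrier_mat n r" and T: "T \<in> carrier_mat r c"
  shows "vec_space.rank n (X * T) \<le> vec_space.rank n (X :: real mat)"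
proof -
  interpret vec_space "TYPE(real)" n .
  let ?S = "set (cols (X * T))" and ?T = "set (cols X)"
  have XT: "X * T \<in> carrier_mat n c" using X T by auto
  have T_carr: "?T \<subseteq> carrier_vec n" using X cols_dim by blast
  have "?S \<subseteq> span ?T"
  proof
    fix v assume "v \<in> ?S"
    then obtain j where j: "j < c" "v = col (X * T) j"
      using XT by (auto simp: cols_def)
    then have v: "v = X *\<^sub>v col T j" using X T col_mult2[OF X T] by simp
    have "mat_of_cols n (cols X) = X" using X by auto
    then have "v = lincomb_list (\<lambda>i. col T j $ i) (cols X)"
      using v X T T_carr by (subst lincomb_list_as_mat_mult) (auto intro!: arg_cong2[where f = mult_mat_vec])
    then have "v \<in> span_list (cols X)" unfolding span_list_def by auto
    then show "v \<in> span ?T" using span_list_as_span[OF T_carr] by simp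
  qed
  then have span_sub: "span ?S \<subseteq> span ?T"
    using T_carr by (metis span_is_subset span_is_submodule)
  have sub: "VectorSpace.subspace class_ring (span A) V" if "A \<subseteq> carrier_vec n" for A
    using span_is_subspace that by simp
  have S_carr: "?S \<subseteq> carrier_vec n" using XT cols_dim by blast
  have "VectorSpace.subspace class_ring (span ?S) (span_vs ?T)"
    by (rule nested_subspaces[OF sub[OF T_carr] sub[OF S_carr] span_sub])
  moreover have "vectorspace class_ring (span_vs ?T)"
    by (rule subspace_is_vs[OF sub[OF T_carr]])
  ultimately show ?thesis
    unfolding rank_def
    using vectorspace.subspace_dim[of class_ring "span_vs ?T" "span ?S"]
      fin_dim_span_cols[OF X] fin_dim_span_cols[OF XT] by simp
qed

section \<open>Positive semidefinite matrices\<close>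

lemma eq_0_if_quadratic_nonneg:
  fixes a b :: real
  assumes "\<And>t. 0 \<le> 2 * t * a + t\<^sup>2 * b"
  shows "a = 0"
proof (rule ccontr)
  assume a: "a \<noteq> 0"
  define s where "s = \<bar>b\<bar> + 1"
  have s: "s > 0" "b < s" by (auto simp: s_def)
  have "0 \<le> 2 * (- a / s) * a + (- a / s)\<^sup>2 * b" by (rule assms)
  also have "\<dots> = (a\<^sup>2 / s) * (b / s - 2)"
    using s by (simp add: field_simps power2_eq_square)
  also have "\<dots> < 0"
  proof (rule mult_pos_neg)
    show "0 < a\<^sup>2 / s" using a s by simp
    have "b / s < 1" using s by simp
    then show "b / s - 2 < 0" by simp
  qed
  finally show False by simp
qed

lemma sym_matsD:
  assumes "M \<in> sym_mats n"
  shows "M \<in> carrier_mat n n" "transpose_mat M = M"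
  using assms by (auto simp: sym_mats_def)

lemma sym_mats_index:
  assumes "M \<in> sym_mats n" "i < n" "j < n"
  shows "M $$ (i, j) = M $$ (j, i)"
  using sym_matsD[OF assms(1)] assms(2,3) by (metis carrier_matD index_transpose_mat(1))

lemma sym_matsI:
  assumes "M \<in> carrier_mat n n" "\<And>i j. i < n \<Longrightarrow> j < n \<Longrightarrow> M $$ (i, j) = M $$ (j, i)"
  shows "M \<in> sym_mats n"
  using assms by (auto simp: sym_mats_def)

lemma sym_mats_scalar_prod:
  assumes M: "M \<in> sym_mats n" and "v \<in> carrier_vec n" "w \<in> carrier_vec n"
  shows "v \<bullet> (M *\<^sub>v w) = w \<bullet> (M *\<^sub>v v)"
  using transpose_vec_mult_scalar[of M n n w v] sym_matsD[OF M] assms(2,3)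
  by (metis comm_scalar_prod mult_mat_vec_carrier)

lemma psd_matsD:
  assumes "M \<in> psd_mats n"
  shows "M \<in> sym_mats n" "v \<in> carrier_vec n \<Longrightarrow> 0 \<le> v \<bullet> (M *\<^sub>v v)"
  using assms by (auto simp: psd_mats_def)

lemma quadratic_form_line:
  assumes M: "M \<in> sym_mats n" and v: "v \<in> carrier_vec n" and w: "w \<in> carrier_vec n"
  shows "(v + t \<cdot>\<^sub>v w) \<bullet> (M *\<^sub>v (v + t \<cdot>\<^sub>v w))
    = v \<bullet> (M *\<^sub>v v) + 2 * t * (w \<bullet> (M *\<^sub>v v)) + t\<^sup>2 * (w \<bullet> (M *\<^sub>v w))"
proof -
  have Mc: "M \<in> carrier_mat n n" using sym_matsD[OF M] by simp
  have c: "M *\<^sub>v v \<in> carrier_vec n" "M *\<^sub>v w \<in> carrier_vec n" using Mc v w by auto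
  have "M *\<^sub>v (v + t \<cdot>\<^sub>v w) = M *\<^sub>v v + t \<cdot>\<^sub>v (M *\<^sub>v w)"
    using Mc v w by (simp add: mult_add_distrib_mat_vec[of _ n n] mult_mat_vec[of _ n n])
  then show ?thesis
    using v w c sym_mats_scalar_prod[OF M v w]
    by (simp add: add_scalar_prod_distrib[of _ n] scalar_prod_add_distrib[of _ n]
        power2_eq_square algebra_simps)
qed

lemma psd_mats_kernel:
  assumes M: "M \<in> psd_mats n" and v: "v \<in> carrier_vec n" and 0: "v \<bullet> (M *\<^sub>v v) = 0"
  shows "M *\<^sub>v v = 0\<^sub>v n"
proof -
  have Mc: "M \<in> carrier_mat n n" and Ms: "M \<in> sym_mats n"
    using psd_matsD[OF M] sym_matsD by auto
  define w where "w = M *\<^sub>v v"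
  have w: "w \<in> carrier_vec n" using Mc v by (simp add: w_def)
  have "0 \<le> 2 * t * (w \<bullet> w) + t\<^sup>2 * (w \<bullet> (M *\<^sub>v w))" for t
    using psd_matsD(2)[OF M, of "v + t \<cdot>\<^sub>v w"] v w
    by (simp add: quadratic_form_line[OF Ms v w] 0[folded w_def] w_def[symmetric])
  then have "w \<bullet> w = 0" by (rule eq_0_if_quadratic_nonneg)
  from scalar_prod_self_eq_0[OF this] w show ?thesis unfolding w_def by (metis carrier_vecD)
qed

lemma mult_unit_vec_eq_col:
  fixes M :: "real mat"
  assumes "M \<in> carrier_mat n m" "i < m"
  shows "M *\<^sub>v unit_vec m i = col M i"
  using assms by (intro eq_vecI) auto

lemma psd_mats_diag_nonneg:
  assumes "M \<in> psd_mats n" "i < n"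
  shows "0 \<le> M $$ (i, i)"
  using psd_matsD(2)[OF assms(1), of "unit_vec n i"] assms(2)
    sym_matsD(1)[OF psd_matsD(1)[OF assms(1)]]
  by (simp add: mult_unit_vec_eq_col)

lemma psd_mats_col_eq_0:
  assumes M: "M \<in> psd_mats n" and i: "i < n" and 0: "M $$ (i, i) = 0"
  shows "col M i = 0\<^sub>v n"
  using psd_mats_kernel[OF M, of "unit_vec n i"] i 0 sym_matsD(1)[OF psd_matsD(1)[OF M]]
  by (simp add: mult_unit_vec_eq_col)

lemma mat_inner_eq_sum:
  assumes "M \<in> carrier_mat n m" "N \<in> carrier_mat n m"
  shows "mat_inner M N = (\<Sum>i<n. \<Sum>j<m. M $$ (i, j) * N $$ (i, j))"
proof -
  have "mat_inner M N = (\<Sum>j<m. \<Sum>i<n. M $$ (i, j) * N $$ (i, j))"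
    using assms
    by (auto simp: mat_inner_def mat_trace_def diag_mat_def sum_list_sum_nth scalar_prod_def
        atLeast0LessThan intro!: sum.cong)
  also have "\<dots> = (\<Sum>i<n. \<Sum>j<m. M $$ (i, j) * N $$ (i, j))" by (rule sum.swap)
  finally show ?thesis .
qed

lemma mat_inner_transpose_mult:
  assumes "A \<in> carrier_mat n n" "U \<in> carrier_mat n r" "P \<in> carrier_mat r r"
  shows "mat_inner A (U * P * transpose_mat U) = mat_inner (transpose_mat U * A * U) P"
proof -
  have ent: "(M * N) $$ (i, j) = (\<Sum>k<b. M $$ (i, k) * N $$ (k, j))"
    if "M \<in> carrier_mat a b" "N \<in> carrier_mat b c" "i < a" "j < c" for M N :: "real mat" and a b c i j
    using that by (auto simp: scalar_prod_def atLeast0LessThan)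
  have UP: "U * P \<in> carrier_mat n r" and UA: "transpose_mat U * A \<in> carrier_mat r n"
    using assms by auto
  have "mat_inner A (U * P * transpose_mat U)
    = (\<Sum>i<n. \<Sum>j<n. A $$ (i, j) * (\<Sum>l<r. (\<Sum>k<r. U $$ (i, k) * P $$ (k, l)) * U $$ (j, l)))"
    using assms UP
    by (subst mat_inner_eq_sum[of _ n n])
      (auto intro!: sum.cong simp: ent[of _ n r _ n] ent[of _ n r _ r] simp del: index_mult_mat(1) assoc_mult_mat)
  also have "\<dots> = (\<Sum>i<n. \<Sum>j<n. \<Sum>l<r. \<Sum>k<r. A $$ (i, j) * U $$ (i, k) * P $$ (k, l) * U $$ (j, l))"
    by (simp add: sum_distrib_left sum_distrib_right mult.assoc)
  also have "\<dots> = (\<Sum>i<n. \<Sum>l<r. \<Sum>j<n. \<Sum>k<r. A $$ (i, j) * U $$ (i, k) * P $$ (k, l) * U $$ (j, l))"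
    by (intro sum.cong refl sum.swap)
  also have "\<dots> = (\<Sum>l<r. \<Sum>i<n. \<Sum>j<n. \<Sum>k<r. A $$ (i, j) * U $$ (i, k) * P $$ (k, l) * U $$ (j, l))"
    by (rule sum.swap)
  also have "\<dots> = (\<Sum>l<r. \<Sum>i<n. \<Sum>k<r. \<Sum>j<n. A $$ (i, j) * U $$ (i, k) * P $$ (k, l) * U $$ (j, l))"
    by (intro sum.cong refl sum.swap)
  also have "\<dots> = (\<Sum>l<r. \<Sum>k<r. \<Sum>i<n. \<Sum>j<n. A $$ (i, j) * U $$ (i, k) * P $$ (k, l) * U $$ (j, l))"
    by (intro sum.cong refl sum.swap)
  also have "\<dots> = (\<Sum>k<r. \<Sum>l<r. \<Sum>i<n. \<Sum>j<n. A $$ (i, j) * U $$ (i, k) * P $$ (k, l) * U $$ (j, l))"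
    by (rule sum.swap)
  also have "\<dots> = (\<Sum>k<r. \<Sum>l<r. \<Sum>j<n. \<Sum>i<n. A $$ (i, j) * U $$ (i, k) * P $$ (k, l) * U $$ (j, l))"
    by (intro sum.cong refl sum.swap)
  also have "\<dots> = (\<Sum>k<r. \<Sum>l<r. (\<Sum>j<n. (\<Sum>i<n. U $$ (i, k) * A $$ (i, j)) * U $$ (j, l)) * P $$ (k, l))"
    unfolding sum_distrib_right by (intro sum.cong refl) (simp add: algebra_simps)
  also have "\<dots> = mat_inner (transpose_mat U * A * U) P"
    using assms UA
    by (subst mat_inner_eq_sum[of _ r r])
      (auto intro!: sum.cong simp: ent[of _ r n _ r] ent[of _ r n _ n] simp del: index_mult_mat(1) assoc_mult_mat)
  finally show ?thesis .
qed

lemma quadratic_form_eq_sum: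
  assumes "M \<in> carrier_mat n n" "v \<in> carrier_vec n"
  shows "v \<bullet> (M *\<^sub>v v) = (\<Sum>i<n. \<Sum>j<n. v $ i * M $$ (i, j) * v $ j)"
  using assms by (auto simp: scalar_prod_def atLeast0LessThan sum_distrib_left mult.assoc intro!: sum.cong)

lemma psd_mats_congruence:
  assumes P: "P \<in> psd_mats n" and L: "L \<in> carrier_mat m n"
  shows "L * P * transpose_mat L \<in> psd_mats m"
proof -
  have Pc: "P \<in> carrier_mat n n" and Pt: "transpose_mat P = P"
    using sym_matsD[OF psd_matsD(1)[OF P]] by auto
  have LP: "L * P \<in> carrier_mat m n" using L Pc by auto
  have "transpose_mat (L * P * transpose_mat L) = L * P * transpose_mat L"
    using L Pc LP Pt transpose_mult[OF LP, of "transpose_mat L" m] transpose_mult[OF L Pc]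
    by (simp add: assoc_mult_mat[of L m n P n "transpose_mat L" m])
  moreover have "0 \<le> v \<bullet> ((L * P * transpose_mat L) *\<^sub>v v)" if v: "v \<in> carrier_vec m" for v
  proof -
    define w where "w = transpose_mat L *\<^sub>v v"
    have w: "w \<in> carrier_vec n" using L v by (auto simp: w_def)
    have "(L * P * transpose_mat L) *\<^sub>v v = (L * P) *\<^sub>v w"
      unfolding w_def using L v LP by (intro assoc_mult_mat_vec[of _ m n]) auto
    also have "\<dots> = L *\<^sub>v (P *\<^sub>v w)"
      using L Pc w by (intro assoc_mult_mat_vec[of _ m n]) auto
    finally have "v \<bullet> ((L * P * transpose_mat L) *\<^sub>v v) = w \<bullet> (P *\<^sub>v w)"
      unfolding w_def using transpose_vec_mult_scalar[OF L, of "P *\<^sub>v w" v] v w Pc by (simp add: w_def)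
    then show ?thesis using psd_matsD(2)[OF P w] by simp
  qed
  ultimately show ?thesis using L LP by (auto simp: psd_mats_def sym_mats_def)
qed

text \<open>Subtracting the rank-one matrix built from a column kills a diagonal entry and keeps positive
  semidefiniteness; iterating it replaces a spectral decomposition.\<close>

lemma psd_mats_peel:
  assumes P: "P \<in> psd_mats n" and i: "i < n" and Pii: "P $$ (i, i) \<noteq> 0"
  defines "Q \<equiv> mat n n (\<lambda>(a, b). P $$ (a, b) - P $$ (a, i) * P $$ (b, i) / P $$ (i, i))"
  shows "Q \<in> psd_mats n"
    and "{j. j < n \<and> Q $$ (j, j) \<noteq> 0} \<subset> {j. j < n \<and> P $$ (j, j) \<noteq> 0}"
proof -
  have Ps: "P \<in> sym_mats n" using psd_matsD[OF P] by simp
  have Pc: "P \<in> carrier_mat n n" using sym_matsD[OF Ps] by simp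
  have Qc: "Q \<in> carrier_mat n n" by (simp add: Q_def)
  have Qs: "Q \<in> sym_mats n"
    using sym_mats_index[OF Ps] by (intro sym_matsI Qc) (simp add: Q_def)
  have "0 \<le> v \<bullet> (Q *\<^sub>v v)" if v: "v \<in> carrier_vec n" for v
  proof -
    define s where "s = (\<Sum>a<n. P $$ (a, i) * v $ a)"
    have row: "unit_vec n i \<bullet> (P *\<^sub>v v) = s"
    proof -
      have "unit_vec n i \<bullet> (P *\<^sub>v v) = (P *\<^sub>v v) $ i"
        using i Pc v by (intro scalar_prod_left_unit) auto
      also have "\<dots> = s"
        using i Pc v sym_mats_index[OF Ps i]
        by (auto simp: s_def scalar_prod_def atLeast0LessThan intro!: sum.cong)
      finally show ?thesis .
    qed
    have Pui: "unit_vec n i \<bullet> (P *\<^sub>v unit_vec n i) = P $$ (i, i)"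
      using i Pc by (simp add: mult_unit_vec_eq_col)
    have "(\<Sum>a<n. \<Sum>b<n. v $ a * (P $$ (a, i) * P $$ (b, i) / P $$ (i, i)) * v $ b) = s * s / P $$ (i, i)"
      unfolding s_def sum_product sum_divide_distrib by (intro sum.cong refl) simp
    then have "v \<bullet> (Q *\<^sub>v v) = v \<bullet> (P *\<^sub>v v) - s * s / P $$ (i, i)"
      unfolding quadratic_form_eq_sum[OF Qc v] quadratic_form_eq_sum[OF Pc v]
      by (simp add: Q_def algebra_simps sum_subtractf)
    also have "\<dots> = (v + (- s / P $$ (i, i)) \<cdot>\<^sub>v unit_vec n i) \<bullet> (P *\<^sub>v (v + (- s / P $$ (i, i)) \<cdot>\<^sub>v unit_vec n i))"
      unfolding quadratic_form_line[OF Ps v unit_vec_carrier] row Pui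
      using Pii by (simp add: field_simps power2_eq_square)
    also have "\<dots> \<ge> 0" using v by (intro psd_matsD(2)[OF P]) auto
    finally show ?thesis .
  qed
  with Qs show "Q \<in> psd_mats n" by (simp add: psd_mats_def)
  have "Q $$ (j, j) = 0" if "j < n" "P $$ (j, j) = 0" for j
  proof -
    have "P $$ (i, j) = 0"
      using psd_mats_col_eq_0[OF P that] i that Pc by (metis carrier_matD(1,2) index_col index_zero_vec(1))
    then show ?thesis using that i sym_mats_index[OF Ps i, of j] by (simp add: Q_def)
  qed
  moreover have "Q $$ (i, i) = 0" using i Pii by (simp add: Q_def)
  ultimately show "{j. j < n \<and> Q $$ (j, j) \<noteq> 0} \<subset> {j. j < n \<and> P $$ (j, j) \<noteq> 0}"
    using i Pii by blast
qed

lemma psd_mats_mult_eq_0: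
  assumes Z: "Z \<in> psd_mats n" and P: "P \<in> psd_mats n"
  shows "0 \<le> mat_inner Z P \<and> (mat_inner Z P = 0 \<longrightarrow> Z * P = 0\<^sub>m n n)"
  using P
proof (induction "card {j. j < n \<and> P $$ (j, j) \<noteq> 0}" arbitrary: P rule: less_induct)
  case less
  note P = less.prems
  have Zc: "Z \<in> carrier_mat n n" and Pc: "P \<in> carrier_mat n n"
    using psd_matsD(1) sym_matsD(1) Z P by auto
  show ?case
  proof (cases "\<exists>i<n. P $$ (i, i) \<noteq> 0")
    case False
    then have "P $$ (a, b) = 0" if "a < n" "b < n" for a b
      using psd_mats_col_eq_0[OF P, of b] that Pc
      by (metis carrier_matD(1,2) index_col index_zero_vec(1))
    then have "P = 0\<^sub>m n n" using Pc by (intro eq_matI) auto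
    then show ?thesis using Zc by (simp add: mat_inner_eq_sum[of _ n n])
  next
    case True
    then obtain i where i: "i < n" "P $$ (i, i) \<noteq> 0" by blast
    then have Pii: "P $$ (i, i) > 0" using psd_mats_diag_nonneg[OF P, of i] by simp
    define Q where "Q = mat n n (\<lambda>(a, b). P $$ (a, b) - P $$ (a, i) * P $$ (b, i) / P $$ (i, i))"
    define c where "c = col P i"
    have Qc: "Q \<in> carrier_mat n n" by (simp add: Q_def)
    have c: "c \<in> carrier_vec n" and c_i: "\<And>a. a < n \<Longrightarrow> c $ a = P $$ (a, i)"
      using Pc i by (auto simp: c_def)
    have PQ: "P $$ (a, b) = Q $$ (a, b) + c $ a * c $ b / P $$ (i, i)" if "a < n" "b < n" for a b
      using that by (simp add: Q_def c_i)
    note peel = psd_mats_peel[OF P i, folded Q_def]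
    have IH: "0 \<le> mat_inner Z Q \<and> (mat_inner Z Q = 0 \<longrightarrow> Z * Q = 0\<^sub>m n n)"
      by (rule less.hyps[OF _ peel(1)]) (intro psubset_card_mono peel(2), simp)
    have inner: "mat_inner Z P = mat_inner Z Q + (c \<bullet> (Z *\<^sub>v c)) / P $$ (i, i)"
      unfolding mat_inner_eq_sum[OF Zc Pc] mat_inner_eq_sum[OF Zc Qc] quadratic_form_eq_sum[OF Zc c]
        sum_divide_distrib sum.distrib[symmetric]
      by (intro sum.cong refl) (simp add: PQ algebra_simps)
    have qc: "0 \<le> c \<bullet> (Z *\<^sub>v c)" using psd_matsD(2)[OF Z c] .
    have qc': "0 \<le> (c \<bullet> (Z *\<^sub>v c)) / P $$ (i, i)" using qc Pii by simp
    have "Z * P = 0\<^sub>m n n" if "mat_inner Z P = 0"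
    proof -
      from that inner IH qc' have ZQ: "Z * Q = 0\<^sub>m n n" and "(c \<bullet> (Z *\<^sub>v c)) / P $$ (i, i) = 0"
        by linarith+
      then have "Z *\<^sub>v c = 0\<^sub>v n" using psd_mats_kernel[OF Z c] Pii by simp
      then have Zci: "(\<Sum>k<n. Z $$ (a, k) * c $ k) = 0" if "a < n" for a
        using that Zc c by (auto simp: scalar_prod_def atLeast0LessThan dest!: arg_cong[of _ _ "\<lambda>v. v $ a"])
      show ?thesis
      proof (rule eq_matI)
        fix a b assume "a < dim_row (0\<^sub>m n n :: real mat)" "b < dim_col (0\<^sub>m n n :: real mat)"
        then have ab: "a < n" "b < n" by auto
        have "(Z * P) $$ (a, b) = (\<Sum>k<n. Z $$ (a, k) * P $$ (k, b))"
          using ab Zc Pc by (auto simp: scalar_prod_def atLeast0LessThan)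
        also have "\<dots> = (\<Sum>k<n. Z $$ (a, k) * Q $$ (k, b))
          + (\<Sum>k<n. Z $$ (a, k) * c $ k) * (c $ b / P $$ (i, i))"
          unfolding sum_distrib_right sum.distrib[symmetric]
          by (intro sum.cong refl) (simp add: PQ ab algebra_simps)
        also have "(\<Sum>k<n. Z $$ (a, k) * Q $$ (k, b)) = (Z * Q) $$ (a, b)"
          using ab Zc Qc by (auto simp: scalar_prod_def atLeast0LessThan)
        finally show "(Z * P) $$ (a, b) = 0\<^sub>m n n $$ (a, b)"
          using ab by (simp add: ZQ Zci)
      qed (use Zc Pc in auto)
    qed
    moreover have "0 \<le> mat_inner Z P" using inner IH qc' by linarith
    ultimately show ?thesis by blast
  qed
qed

section \<open>The theorem of the alternative\<close>

lemma mat_inner_linear: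
  assumes "A \<in> carrier_mat n n" "P \<in> carrier_mat n n" "X \<in> carrier_mat n n"
  shows "mat_inner A (s \<cdot>\<^sub>m P + u \<cdot>\<^sub>m X) = s * mat_inner A P + u * mat_inner A X"
proof -
  have "s \<cdot>\<^sub>m P + u \<cdot>\<^sub>m X \<in> carrier_mat n n" using assms by auto
  then show ?thesis
    using assms
    by (simp add: mat_inner_eq_sum[of _ n n] sum_distrib_left sum.distrib algebra_simps)
qed

lemma pd_mats_combination:
  assumes P: "P \<in> pd_mats n" and X: "X \<in> psd_mats n" and "0 < s" "0 \<le> u"
  shows "s \<cdot>\<^sub>m P + u \<cdot>\<^sub>m X \<in> pd_mats n"
proof -
  have c: "P \<in> carrier_mat n n" "X \<in> carrier_mat n n"
    and sym: "P \<in> sym_mats n" "X \<in> sym_mats n"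
    using P X by (auto simp: pd_mats_def psd_mats_def sym_mats_def)
  have "s \<cdot>\<^sub>m P + u \<cdot>\<^sub>m X \<in> sym_mats n"
    using c sym_mats_index[OF sym(1)] sym_mats_index[OF sym(2)] by (intro sym_matsI) auto
  moreover have "0 < v \<bullet> ((s \<cdot>\<^sub>m P + u \<cdot>\<^sub>m X) *\<^sub>v v)"
    if v: "v \<in> carrier_vec n" "v \<noteq> 0\<^sub>v n" for v
  proof -
    have cc: "s \<cdot>\<^sub>m P + u \<cdot>\<^sub>m X \<in> carrier_mat n n" using c by auto
    have "v \<bullet> ((s \<cdot>\<^sub>m P + u \<cdot>\<^sub>m X) *\<^sub>v v) = s * (v \<bullet> (P *\<^sub>v v)) + u * (v \<bullet> (X *\<^sub>v v))"
      unfolding quadratic_form_eq_sum[OF cc v(1)] quadratic_form_eq_sum[OF c(1) v(1)]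
        quadratic_form_eq_sum[OF c(2) v(1)]
      using c by (simp add: sum_distrib_left sum.distrib algebra_simps)
    moreover have "0 < v \<bullet> (P *\<^sub>v v)" "0 \<le> v \<bullet> (X *\<^sub>v v)"
      using P X v by (auto simp: pd_mats_def psd_mats_def)
    ultimately show ?thesis using assms(3,4) by (simp add: add_pos_nonneg)
  qed
  ultimately show ?thesis by (simp add: pd_mats_def)
qed

lemma compact_Pi_Icc: "compact {z :: 'i \<Rightarrow> real. \<forall>i. z i \<in> {a..b}}"
proof -
  have "compactin (product_topology (\<lambda>i. euclidean) UNIV) (PiE UNIV (\<lambda>i :: 'i. {a..b}))"
    unfolding compactin_PiE by simp
  then have "compact (PiE UNIV (\<lambda>i :: 'i. {a..b}))"
    by (simp add: euclidean_product_topology)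
  moreover have "PiE UNIV (\<lambda>i :: 'i. {a..b}) = {z. \<forall>i. z i \<in> {a..b}}"
    by (auto simp: PiE_def Pi_def)
  ultimately show ?thesis by simp
qed

text \<open>Restricting the entries to \<open>[-1, 1]\<close> makes compactness immediate; the rank-one matrices
  \<open>v v\<^sup>T / (v \<bullet> v)\<close>, the only elements needed later, satisfy the bound. Coordinates outside the
  index range are irrelevant.\<close>

definition psd_base :: "nat \<Rightarrow> (nat \<times> nat \<Rightarrow> real) set" where
  "psd_base n = {z. (\<forall>i. z i \<in> {-1..1}) \<and> mat n n z \<in> psd_mats n \<and> (\<Sum>i<n. z (i, i)) = 1}"

lemma mat_in_psd_mats_iff:
  "mat n n z \<in> psd_mats n \<longleftrightarrow>
    (\<forall>i\<in>{..<n}. \<forall>j\<in>{..<n}. z (i, j) = z (j, i)) \<and>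
    (\<forall>v\<in>carrier_vec n. 0 \<le> (\<Sum>i<n. \<Sum>j<n. v $ i * z (i, j) * v $ j))"
proof -
  have "mat n n z \<in> sym_mats n \<longleftrightarrow> (\<forall>i\<in>{..<n}. \<forall>j\<in>{..<n}. z (i, j) = z (j, i))"
    using sym_mats_index[of "mat n n z" n] sym_matsI[of "mat n n z" n] by fastforce
  then show ?thesis
    by (auto simp: psd_mats_def quadratic_form_eq_sum[of _ n])
qed

lemma compact_psd_base: "compact (psd_base n)"
proof -
  have coord: "continuous_on UNIV (\<lambda>z. z i :: real)" for i :: "nat \<times> nat"
    by (rule continuous_on_product_coordinates)
  have "psd_base n = {z. \<forall>i. z i \<in> {-1..1}} \<inter>
     ((\<Inter>i\<in>{..<n}. \<Inter>j\<in>{..<n}. {z. z (i, j) = z (j, i)}) \<inter>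
      (\<Inter>v\<in>carrier_vec n. {z. 0 \<le> (\<Sum>i<n. \<Sum>j<n. v $ i * z (i, j) * v $ j)}) \<inter>
      {z. (\<Sum>i<n. z (i, i)) = 1})"
    by (auto simp: psd_base_def mat_in_psd_mats_iff)
  moreover have "closed ((\<Inter>i\<in>{..<n}. \<Inter>j\<in>{..<n}. {z :: nat \<times> nat \<Rightarrow> real. z (i, j) = z (j, i)}) \<inter>
      (\<Inter>v\<in>carrier_vec n. {z. 0 \<le> (\<Sum>i<n. \<Sum>j<n. v $ i * z (i, j) * v $ j)}) \<inter>
      {z. (\<Sum>i<n. z (i, i)) = 1})"
    by (intro closed_Int closed_INT ballI closed_Collect_eq closed_Collect_le continuous_intros coord)
  ultimately show ?thesis by (simp only: compact_Int_closed[OF compact_Pi_Icc])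
qed

lemma convex_psd_base:
  assumes x: "x \<in> psd_base n" and y: "y \<in> psd_base n" and t: "0 \<le> t" "t \<le> 1"
  shows "(\<lambda>i. (1 - t) * x i + t * y i) \<in> psd_base n"
proof -
  have "(1 - t) * x i + t * y i \<in> {-1..1}" for i
  proof -
    have "x i \<in> {-1..1}" "y i \<in> {-1..1}" using x y by (simp_all add: psd_base_def del: split_paired_All)
    then have "\<bar>x i\<bar> \<le> 1" "\<bar>y i\<bar> \<le> 1" by auto
    then have "(1 - t) * \<bar>x i\<bar> \<le> (1 - t) * 1" "t * \<bar>y i\<bar> \<le> t * 1"
      using t by (intro mult_left_mono; simp)+
    moreover have "\<bar>(1 - t) * x i + t * y i\<bar> \<le> (1 - t) * \<bar>x i\<bar> + t * \<bar>y i\<bar>"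
      using t abs_triangle_ineq[of "(1 - t) * x i" "t * y i"] by (simp add: abs_mult)
    ultimately have "\<bar>(1 - t) * x i + t * y i\<bar> \<le> 1" by simp
    then show ?thesis by auto
  qed
  moreover have "0 \<le> (\<Sum>i<n. \<Sum>j<n. v $ i * ((1 - t) * x (i, j) + t * y (i, j)) * v $ j)"
    if v: "v \<in> carrier_vec n" for v
  proof -
    have "(\<Sum>i<n. \<Sum>j<n. v $ i * ((1 - t) * x (i, j) + t * y (i, j)) * v $ j)
      = (1 - t) * (\<Sum>i<n. \<Sum>j<n. v $ i * x (i, j) * v $ j)
        + t * (\<Sum>i<n. \<Sum>j<n. v $ i * y (i, j) * v $ j)"
      unfolding sum_distrib_left sum.distrib[symmetric]
      by (intro sum.cong refl) (simp add: algebra_simps)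
    also have "\<dots> \<ge> 0"
      using x y v t by (auto simp: psd_base_def mat_in_psd_mats_iff intro!: add_nonneg_nonneg mult_nonneg_nonneg)
    finally show ?thesis .
  qed
  moreover have "(\<Sum>i<n. (1 - t) * x (i, i) + t * y (i, i)) = 1"
    using x y by (simp add: psd_base_def sum.distrib sum_distrib_left[symmetric])
  moreover have "\<forall>i\<in>{..<n}. \<forall>j\<in>{..<n}. (1 - t) * x (i, j) + t * y (i, j) = (1 - t) * x (j, i) + t * y (j, i)"
    using x y by (auto simp: psd_base_def mat_in_psd_mats_iff)
  ultimately show ?thesis by (simp add: psd_base_def mat_in_psd_mats_iff)
qed

lemma rank_one_in_psd_base:
  assumes v: "v \<in> carrier_vec n" "v \<noteq> 0\<^sub>v n"
  shows "(\<lambda>(i, j). if i < n \<and> j < n then v $ i * v $ j / (v \<bullet> v) else 0) \<in> psd_base n"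
    (is "?d \<in> _") and "0 < v \<bullet> v"
proof -
  have vv: "v \<bullet> v = (\<Sum>i<n. v $ i * v $ i)"
    using v by (auto simp: scalar_prod_def atLeast0LessThan)
  have "v \<bullet> v \<noteq> 0" using scalar_prod_self_eq_0[of v] v by auto
  moreover have "0 \<le> v \<bullet> v" unfolding vv by (intro sum_nonneg) auto
  ultimately show pos: "0 < v \<bullet> v" by simp
  have bd: "\<bar>v $ i * v $ j\<bar> \<le> v \<bullet> v" if "i < n" "j < n" for i j
  proof -
    have sq: "v $ k * v $ k \<le> v \<bullet> v" if "k < n" for k
      unfolding vv using that by (intro member_le_sum) auto
    have "2 * \<bar>v $ i * v $ j\<bar> \<le> v $ i * v $ i + v $ j * v $ j"
      using sum_squares_bound[of "\<bar>v $ i\<bar>" "\<bar>v $ j\<bar>"] by (simp add: abs_mult power2_eq_square)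
    with sq[OF that(1)] sq[OF that(2)] show ?thesis by linarith
  qed
  have "?d i \<in> {-1..1}" for i
    using bd[of "fst i" "snd i"] pos by (auto simp: abs_le_iff field_simps split: prod.split)
  moreover have "(\<Sum>i<n. ?d (i, i)) = 1"
    using pos vv by (simp add: sum_divide_distrib[symmetric])
  moreover have "0 \<le> (\<Sum>i<n. \<Sum>j<n. w $ i * ?d (i, j) * w $ j)" for w
  proof -
    have "(\<Sum>i<n. \<Sum>j<n. w $ i * ?d (i, j) * w $ j) = (\<Sum>i<n. w $ i * v $ i) * (\<Sum>j<n. w $ j * v $ j) / (v \<bullet> v)"
      unfolding sum_product sum_divide_distrib by (intro sum.cong refl) simp
    also have "\<dots> \<ge> 0" using pos by simp
    finally show ?thesis .
  qed
  moreover have "\<forall>i\<in>{..<n}. \<forall>j\<in>{..<n}. ?d (i, j) = ?d (j, i)" by (simp add: mult.commute)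
  ultimately show "?d \<in> psd_base n"
    unfolding psd_base_def mat_in_psd_mats_iff by blast
qed

text \<open>The functions \<open>W k\<close> span the combinations \<open>\<Sum>\<^sub>i y\<^sub>i A\<^sub>i\<close> with \<open>b \<bullet> y = 0\<close>, including the case
  \<open>b = 0\<close>, where \<open>b $ k / \<beta> = 0\<close>. Orthogonality of \<open>P\<close> to them says that \<open>\<A>(P)\<close> is a multiple \<open>t b\<close>,
  and a positive combination of \<open>P\<close> with the given solution \<open>X\<close> corrects the factor \<open>t\<close>.\<close>

lemma theorem_of_alternative:
  assumes As: "set As \<subseteq> sym_mats n" and b: "b \<in> carrier_vec (length As)"
    and X: "X \<in> psd_mats n" "lin_op As X = b"
    and aux: "\<And>Z. Z \<in> aux_solutions n As b \<Longrightarrow> Z = 0\<^sub>m n n"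
  shows "\<exists>P\<in>pd_mats n. lin_op As P = b"
proof (cases "n = 0")
  case True
  then have "X \<in> pd_mats n" using X(1) by (auto simp: psd_mats_def pd_mats_def)
  then show ?thesis using X(2) by blast
next
  case False
  define l where "l = length As"
  define \<beta> where "\<beta> = (\<Sum>k<l. b $ k * b $ k)"
  define I where "I = {..<n} \<times> {..<n}"
  define W where "W k = (\<lambda>i. As ! k $$ i - b $ k / \<beta> * (\<Sum>m<l. b $ m * As ! m $$ i))" for k
  have Ak: "As ! k \<in> sym_mats n" "As ! k \<in> carrier_mat n n" if "k < l" for k
  proof -
    show "As ! k \<in> sym_mats n" using As that nth_mem by (force simp: l_def)
    then show "As ! k \<in> carrier_mat n n" by (rule sym_matsD)
  qed
  have \<beta>: "b $ k = 0" if "\<beta> = 0" "k < l" for k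
  proof -
    have "\<forall>k\<in>{..<l}. b $ k * b $ k = 0"
      using that(1) unfolding \<beta>_def by (subst (asm) sum_nonneg_eq_0_iff) auto
    with that show ?thesis by simp
  qed
  have W_comb: "(\<Sum>k<l. y k * W k i)
      = (\<Sum>k<l. As ! k $$ i * (y k - (\<Sum>m<l. y m * b $ m) / \<beta> * b $ k))" for y i
  proof -
    have "(\<Sum>k<l. y k * W k i) = (\<Sum>k<l. y k * As ! k $$ i)
        - (\<Sum>k<l. y k * b $ k) * (\<Sum>m<l. b $ m * As ! m $$ i) / \<beta>"
      unfolding W_def right_diff_distrib sum_subtractf sum_distrib_right sum_divide_distrib
      by (simp add: sum_distrib_left sum_divide_distrib mult.assoc)
    also have "\<dots> = (\<Sum>k<l. As ! k $$ i * (y k - (\<Sum>m<l. y m * b $ m) / \<beta> * b $ k))"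
      unfolding right_diff_distrib sum_subtractf
      by (simp add: sum_distrib_left sum_divide_distrib mult.commute mult.left_commute)
    finally show ?thesis .
  qed
  have disj: "\<exists>i\<in>I. z i \<noteq> (\<Sum>k<l. y k * W k i)" if z: "z \<in> psd_base n" for z y
  proof (rule ccontr)
    assume "\<not> ?thesis"
    then have eq: "z i = (\<Sum>k<l. y k * W k i)" if "i \<in> I" for i using that by blast
    define c where "c = (\<Sum>m<l. y m * b $ m)"
    define y' where "y' = vec l (\<lambda>k. y k - c / \<beta> * b $ k)"
    have y': "y' \<in> carrier_vec (length As)" by (simp add: y'_def l_def)
    have "b \<bullet> y' = (\<Sum>k<l. b $ k * y k) - c / \<beta> * \<beta>"
      by (simp add: y'_def scalar_prod_def atLeast0LessThan right_diff_distrib sum_subtractf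
          sum_distrib_left sum_divide_distrib \<beta>_def mult.commute mult.left_commute)
    also have "\<dots> = 0"
      using \<beta> by (cases "\<beta> = 0") (simp_all add: c_def mult.commute)
    finally have "b \<bullet> y' = 0" .
    moreover have "mat n n z = mat_lincomb n As y'"
    proof (rule eq_matI)
      fix i j assume "i < dim_row (mat_lincomb n As y')" "j < dim_col (mat_lincomb n As y')"
      then have ij: "i < n" "j < n" by (auto simp: mat_lincomb_def)
      then have "z (i, j) = (\<Sum>k<l. As ! k $$ (i, j) * y' $ k)"
        using eq[of "(i, j)"] by (simp add: I_def W_comb y'_def c_def)
      then show "mat n n z $$ (i, j) = mat_lincomb n As y' $$ (i, j)"
        using ij by (simp add: mat_lincomb_def l_def)
    qed (auto simp: mat_lincomb_def)
    ultimately have "mat n n z \<in> aux_solutions n As b"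
      using z y' unfolding aux_solutions_def psd_base_def by blast
    then have "mat n n z = 0\<^sub>m n n" by (rule aux)
    then have "z (i, i) = 0" if "i < n" for i
      using that by (metis index_mat(1) index_zero_mat(1))
    then show False using z by (simp add: psd_base_def)
  qed
  have "unit_vec n 0 \<in> carrier_vec n" "unit_vec n 0 \<noteq> (0\<^sub>v n :: real vec)"
    using False by auto
  from rank_one_in_psd_base(1)[OF this] have ne: "psd_base n \<noteq> {}" by blast
  obtain z y where z: "z \<in> psd_base n"
    and orth: "\<And>k. k < l \<Longrightarrow> idot I (\<lambda>i. z i - (\<Sum>k<l. y k * W k i)) (W k) = 0"
    and pos: "\<And>d. d \<in> psd_base n \<Longrightarrow> 0 < idot I (\<lambda>i. z i - (\<Sum>k<l. y k * W k i)) d"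
    using separation_compact_convex_span[OF _ compact_psd_base ne convex_psd_base disj]
    unfolding I_def Let_def by blast
  define p where "p = (\<lambda>i. z i - (\<Sum>k<l. y k * W k i))"
  define P where "P = mat n n p"
  have Pc: "P \<in> carrier_mat n n" by (simp add: P_def)
  have idot_I: "idot I p f = (\<Sum>i<n. \<Sum>j<n. P $$ (i, j) * f (i, j))" for f
    unfolding idot_def I_def by (simp add: sum.cartesian_product P_def)
  have "P \<in> sym_mats n"
  proof (rule sym_matsI[OF Pc])
    fix i j assume ij: "i < n" "j < n"
    have "W k (i, j) = W k (j, i)" if "k < l" for k
      using ij sym_mats_index[OF Ak(1)] that by (simp add: W_def)
    moreover have "z (i, j) = z (j, i)" using z ij by (simp add: psd_base_def mat_in_psd_mats_iff)
    ultimately show "P $$ (i, j) = P $$ (j, i)" using ij by (simp add: P_def p_def)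
  qed
  moreover have "0 < v \<bullet> (P *\<^sub>v v)" if v: "v \<in> carrier_vec n" "v \<noteq> 0\<^sub>v n" for v
  proof -
    note d = rank_one_in_psd_base[OF v]
    from pos[OF d(1)] have "0 < (v \<bullet> (P *\<^sub>v v)) / (v \<bullet> v)"
      unfolding p_def[symmetric] idot_I quadratic_form_eq_sum[OF Pc v(1)] sum_divide_distrib
      by (simp add: mult.commute mult.left_commute)
    with d(2) show ?thesis by (simp add: zero_less_divide_iff)
  qed
  ultimately have P: "P \<in> pd_mats n" by (simp add: pd_mats_def)
  define t where "t = (\<Sum>m<l. b $ m * mat_inner (As ! m) P) / \<beta>"
  have inner_P: "mat_inner (As ! k) P = t * b $ k" if k: "k < l" for k
  proof -
    have inner: "mat_inner (As ! m) P = idot I p (\<lambda>i. As ! m $$ i)" if "m < l" for m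
      unfolding idot_I using Ak(2)[OF that] Pc by (simp add: mat_inner_eq_sum[of _ n n] mult.commute)
    have "0 = idot I p (W k)" using orth[OF k] by (simp add: p_def)
    also have "\<dots> = idot I p (\<lambda>i. As ! k $$ i)
        - b $ k / \<beta> * (\<Sum>m<l. b $ m * idot I p (\<lambda>i. As ! m $$ i))"
      unfolding W_def idot_commute[of I p] idot_diff idot_scale idot_sum ..
    finally show ?thesis using inner k by (simp add: t_def mult.commute)
  qed
  define s u where "s = (if t > 0 then 1 / t else 1)" and "u = (if t > 0 then 0 else 1 - t)"
  have su: "0 < s" "0 \<le> u" "s * t + u = 1" by (auto simp: s_def u_def)
  have Xc: "X \<in> carrier_mat n n" using X(1) by (auto simp: psd_mats_def sym_mats_def)
  have "lin_op As (s \<cdot>\<^sub>m P + u \<cdot>\<^sub>m X) = b"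
  proof (rule eq_vecI)
    fix k assume "k < dim_vec b"
    then have k: "k < l" using b by (simp add: l_def)
    have "mat_inner (As ! k) X = b $ k"
      using k arg_cong[OF X(2), of "\<lambda>v. v $ k"] by (simp add: lin_op_def l_def)
    then have "mat_inner (As ! k) (s \<cdot>\<^sub>m P + u \<cdot>\<^sub>m X) = (s * t + u) * b $ k"
      using k by (simp add: mat_inner_linear[OF Ak(2) Pc Xc] inner_P algebra_simps)
    then show "lin_op As (s \<cdot>\<^sub>m P + u \<cdot>\<^sub>m X) $ k = b $ k"
      using k su(3) by (simp add: lin_op_def l_def)
  qed (use b in \<open>simp add: lin_op_def\<close>)
  then show ?thesis using pd_mats_combination[OF P X(1) su(1,2)] by blast
qed

section \<open>Facial reduction\<close>

lemma assoc_mult_mat_dim: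
  fixes A :: "'a :: semiring_0 mat"
  shows "dim_col A = dim_row B \<Longrightarrow> dim_col B = dim_row C \<Longrightarrow> A * B * C = A * (B * C)"
  by (rule assoc_mult_mat[of A "dim_row A" "dim_col A" B "dim_col B" C "dim_col C"]) auto

lemma psd_mats_factor_kernel:
  assumes Z: "Z \<in> carrier_mat n n" and V: "null_space_basis n Z V"
    and X: "X \<in> psd_mats n" and ZX: "Z * X = 0\<^sub>m n n"
  shows "\<exists>P\<in>psd_mats (dim_col V). X = V * P * transpose_mat V"
proof -
  define r where "r = dim_col V"
  note D = null_space_basisD[OF Z V, folded r_def]
  obtain L where L: "L \<in> carrier_mat r n" "L * V = 1\<^sub>m r"
    using ex_left_inverse[OF D(1,3)] by blast
  have Xc: "X \<in> carrier_mat n n" and Xt: "transpose_mat X = X"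
    using sym_matsD psd_matsD(1)[OF X] by auto
  define E where "E = V * L"
  have E: "E \<in> carrier_mat n n" using D(1) L by (simp add: E_def)
  have EX: "E * X = X"
  proof (rule eq_matI)
    fix i j assume "i < dim_row X" "j < dim_col X"
    then have ij: "i < n" "j < n" using Xc by auto
    have colc: "col X j \<in> carrier_vec n" using Xc ij by auto
    have "Z *\<^sub>v col X j = col (Z * X) j" using col_mult2[OF Z Xc ij(2)] by simp
    also have "\<dots> = 0\<^sub>v n" using ij by (simp add: ZX)
    finally obtain x where x: "x \<in> carrier_vec r" "col X j = V *\<^sub>v x"
      using D(4) colc by blast
    have "E *\<^sub>v col X j = V *\<^sub>v (L *\<^sub>v col X j)"
      unfolding E_def using D(1) L(1) colc by (rule assoc_mult_mat_vec)
    also have "\<dots> = col X j"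
      unfolding x(2) left_inverse_mult_vec[OF D(1) L x(1)] ..
    finally have "col (E * X) j = col X j" using col_mult2[OF E Xc ij(2)] by simp
    then have "col (E * X) j $ i = col X j $ i" by simp
    then show "(E * X) $$ (i, j) = X $$ (i, j)" using ij E Xc by simp
  qed (use E Xc in auto)
  define P where "P = L * X * transpose_mat L"
  have P: "P \<in> psd_mats r" unfolding P_def by (rule psd_mats_congruence[OF X L(1)])
  have "V * P * transpose_mat V = E * (X * transpose_mat E)"
    unfolding P_def E_def transpose_mult[OF D(1) L(1)]
    using carrier_matD[OF D(1)] carrier_matD[OF L(1)] carrier_matD[OF Xc]
    by (simp add: assoc_mult_mat_dim del: assoc_mult_mat)
  also have "\<dots> = X * transpose_mat E"
    using assoc_mult_mat[OF E Xc, of "transpose_mat E" n] E EX by simp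
  also have "\<dots> = transpose_mat (E * X)"
    using transpose_mult[OF E Xc] Xt by simp
  finally show ?thesis using P EX Xt unfolding r_def by auto
qed

lemma mat_inner_mat_lincomb:
  assumes "set As \<subseteq> carrier_mat n n" "P \<in> carrier_mat n n" "y \<in> carrier_vec (length As)"
  shows "mat_inner (mat_lincomb n As y) P = lin_op As P \<bullet> y"
proof -
  have Ai: "As ! k \<in> carrier_mat n n" if "k < length As" for k using assms(1) that by auto
  have "mat_lincomb n As y \<in> carrier_mat n n" by (simp add: mat_lincomb_def)
  then have "mat_inner (mat_lincomb n As y) P
      = (\<Sum>i<n. \<Sum>j<n. \<Sum>k<length As. As ! k $$ (i, j) * P $$ (i, j) * y $ k)"
    using assms(2) by (simp add: mat_inner_eq_sum[of _ n n] mat_lincomb_def sum_distrib_left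
        sum_distrib_right mult.commute mult.left_commute)
  also have "\<dots> = (\<Sum>i<n. \<Sum>k<length As. \<Sum>j<n. As ! k $$ (i, j) * P $$ (i, j) * y $ k)"
    by (intro sum.cong refl sum.swap)
  also have "\<dots> = (\<Sum>k<length As. \<Sum>i<n. \<Sum>j<n. As ! k $$ (i, j) * P $$ (i, j) * y $ k)"
    by (rule sum.swap)
  also have "\<dots> = lin_op As P \<bullet> y"
    using assms(3) Ai assms(2)
    by (auto simp: lin_op_def scalar_prod_def atLeast0LessThan mat_inner_eq_sum[of _ n n]
        sum_distrib_right intro!: sum.cong)
  finally show ?thesis .
qed

lemma lin_op_congruence:
  assumes "set As \<subseteq> carrier_mat k k" "U \<in> carrier_mat k r" "P \<in> carrier_mat r r"
  shows "lin_op (map (\<lambda>M. transpose_mat U * M * U) As) P = lin_op As (U * P * transpose_mat U)"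
proof (rule eq_vecI)
  fix i assume "i < dim_vec (lin_op As (U * P * transpose_mat U))"
  then have i: "i < length As" by (simp add: lin_op_def)
  then have "As ! i \<in> carrier_mat k k" using assms(1) by auto
  then show "lin_op (map (\<lambda>M. transpose_mat U * M * U) As) P $ i = lin_op As (U * P * transpose_mat U) $ i"
    using i mat_inner_transpose_mult[OF _ assms(2,3)] by (simp add: lin_op_def)
qed (simp add: lin_op_def)

lemma sym_mats_congruence:
  assumes M: "M \<in> sym_mats k" and U: "U \<in> carrier_mat k r"
  shows "transpose_mat U * M * U \<in> sym_mats r"
proof -
  have Mc: "M \<in> carrier_mat k k" using sym_matsD[OF M] by simp
  have UM: "transpose_mat U * M \<in> carrier_mat r k" using U Mc by auto
  have "transpose_mat (transpose_mat U * M * U) = transpose_mat U * (M * U)"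
    using transpose_mult[OF UM U] transpose_mult[of "transpose_mat U" r k M k] U Mc sym_matsD(2)[OF M]
    by simp
  also have "\<dots> = transpose_mat U * M * U"
    using U Mc by (simp add: assoc_mult_mat[of _ r k M k U r])
  finally show ?thesis using U Mc by (auto simp: sym_mats_def)
qed

definition fra_invariant :: "nat \<Rightarrow> real mat list \<Rightarrow> real vec \<Rightarrow> real mat \<Rightarrow> fra_state \<Rightarrow> bool" where
  "fra_invariant k As b B = (\<lambda>(j, Cs, U).
     U \<in> carrier_mat k (dim_col U) \<and>
     (\<forall>x\<in>carrier_vec (dim_col U). U *\<^sub>v x = 0\<^sub>v k \<longrightarrow> x = 0\<^sub>v (dim_col U)) \<and>
     Cs = map (\<lambda>M. transpose_mat U * M * U) As \<and>
     1 \<le> j \<and> (j = 1 \<longrightarrow> U = 1\<^sub>m k) \<and>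
     (j > 1 \<longrightarrow> transpose_mat B * U = 0\<^sub>m (dim_col B) (dim_col U)) \<and>
     (\<forall>X\<in>feasible_set k As b B. \<exists>P\<in>psd_mats (dim_col U). X = U * P * transpose_mat U))"

lemma fra_invariant_init:
  assumes As: "set As \<subseteq> carrier_mat k k"
  shows "fra_invariant k As b B (fra_init k As)"
proof -
  have "map (\<lambda>M. transpose_mat (1\<^sub>m k) * M * 1\<^sub>m k) As = As"
    using As by (intro map_idI) auto
  moreover have "\<exists>P\<in>psd_mats k. X = 1\<^sub>m k * P * transpose_mat (1\<^sub>m k)"
    if "X \<in> feasible_set k As b B" for X
    using that by (intro bexI[of _ X]) (auto simp: feasible_set_def psd_mats_def sym_mats_def)
  ultimately show ?thesis by (auto simp: fra_invariant_def fra_init_def)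
qed

lemma fra_invariant_choice:
  assumes inv: "fra_invariant k As b B (j, Cs, U)" and B: "B \<in> carrier_mat k m"
    and ch: "fra_choice b B (j, Cs, U) Z"
  shows "Z \<in> carrier_mat (dim_col U) (dim_col U)" "Z \<in> psd_mats (dim_col U)"
proof -
  show "Z \<in> psd_mats (dim_col U)"
  proof (cases "j = 1")
    case True
    have "1\<^sub>m m \<in> psd_mats m"
    proof -
      have "0 \<le> v \<bullet> v" for v :: "real vec"
        unfolding scalar_prod_def by (intro sum_nonneg) auto
      then show ?thesis by (auto simp: psd_mats_def sym_mats_def)
    qed
    from psd_mats_congruence[OF this B] B True inv ch show ?thesis
      by (auto simp: fra_choice_def fra_invariant_def)
  next
    case False
    with ch show ?thesis by (auto simp: fra_choice_def aux_solutions_def)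
  qed
  then show "Z \<in> carrier_mat (dim_col U) (dim_col U)" by (auto simp: psd_mats_def sym_mats_def)
qed

lemma fra_invariant_step:
  assumes inv: "fra_invariant k As b B s" and step: "fra_step b B s s'"
    and As: "set As \<subseteq> carrier_mat k k" and B: "B \<in> carrier_mat k m"
  shows "fra_invariant k As b B s'"
proof -
  obtain j Cs U where s: "s = (j, Cs, U)" by (cases s)
  define r where "r = dim_col U"
  from step[unfolded s fra_step_def] obtain Z V where ch: "fra_choice b B (j, Cs, U) Z"
    and V: "null_space_basis r Z V"
    and s': "s' = (j + 1, map (\<lambda>M. transpose_mat V * M * V) Cs, U * V)"
    unfolding r_def by blast
  from inv[unfolded s fra_invariant_def] have U: "U \<in> carrier_mat k r"
    and Uinj: "\<And>x. x \<in> carrier_vec r \<Longrightarrow> U *\<^sub>v x = 0\<^sub>v k \<Longrightarrow> x = 0\<^sub>v r"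
    and Cs: "Cs = map (\<lambda>M. transpose_mat U * M * U) As"
    and j: "1 \<le> j" "j = 1 \<Longrightarrow> U = 1\<^sub>m k"
    and BU: "j > 1 \<Longrightarrow> transpose_mat B * U = 0\<^sub>m (dim_col B) r"
    and facU: "\<And>X. X \<in> feasible_set k As b B \<Longrightarrow> \<exists>P\<in>psd_mats r. X = U * P * transpose_mat U"
    by (auto simp: r_def)
  note Z = fra_invariant_choice[OF inv[unfolded s] B ch, folded r_def]
  define q where "q = dim_col V"
  note D = null_space_basisD[OF Z(1) V, folded q_def]
  have UV: "U * V \<in> carrier_mat k q" using U D(1) by auto
  have inj: "x = 0\<^sub>v q" if x: "x \<in> carrier_vec q" "(U * V) *\<^sub>v x = 0\<^sub>v k" for x
  proof -
    have "U *\<^sub>v (V *\<^sub>v x) = 0\<^sub>v k" using x(2) assoc_mult_mat_vec[OF U D(1) x(1)] by simp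
    then have "V *\<^sub>v x = 0\<^sub>v r" using Uinj D(1) x(1) by simp
    then show ?thesis using D(3) x(1) by simp
  qed
  have maps: "map (\<lambda>M. transpose_mat V * M * V) Cs = map (\<lambda>M. transpose_mat (U * V) * M * (U * V)) As"
    unfolding Cs map_map
  proof (rule map_cong[OF refl])
    fix M assume "M \<in> set As"
    then have M: "M \<in> carrier_mat k k" using As by auto
    have VU: "transpose_mat (U * V) = transpose_mat V * transpose_mat U"
      by (rule transpose_mult[OF U D(1)])
    show "((\<lambda>M. transpose_mat V * M * V) \<circ> (\<lambda>M. transpose_mat U * M * U)) M
      = transpose_mat (U * V) * M * (U * V)"
      unfolding VU o_def
      using carrier_matD[OF M] carrier_matD[OF U] carrier_matD[OF D(1)]
      by (simp add: assoc_mult_mat_dim del: assoc_mult_mat)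
  qed
  have BUV: "transpose_mat B * (U * V) = 0\<^sub>m (dim_col B) q"
  proof (cases "j = 1")
    case True
    then have U1: "U = 1\<^sub>m k" and r: "r = k" and ZB: "Z = B * transpose_mat B"
      using j ch by (auto simp: r_def fra_choice_def)
    have Vc: "V \<in> carrier_mat k q" using D(1) r by simp
    have Bt: "transpose_mat B \<in> carrier_mat m k" using B by simp
    have "transpose_mat B * V = 0\<^sub>m m q"
    proof (rule eq_matI)
      fix a c assume "a < dim_row (0\<^sub>m m q :: real mat)" "c < dim_col (0\<^sub>m m q :: real mat)"
      then have ac: "a < m" "c < q" by auto
      have colc: "col V c \<in> carrier_vec k" using Vc ac by auto
      have "Z *\<^sub>v col V c = 0\<^sub>v k"
        using col_mult2[OF Z(1) D(1) ac(2)] D(2) ac r by simp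
      then have "transpose_mat B *\<^sub>v col V c = 0\<^sub>v m"
        using kernel_transpose_mult_self[OF Bt colc] ZB by simp
      then have "(transpose_mat B *\<^sub>v col V c) $ a = 0" using ac by simp
      then show "(transpose_mat B * V) $$ (a, c) = 0\<^sub>m m q $$ (a, c)" using ac B Vc by simp
    qed (use B Vc in auto)
    then show ?thesis using U1 Vc B by simp
  next
    case False
    then have "transpose_mat B * U = 0\<^sub>m m r" using BU j B by simp
    then show ?thesis
      using assoc_mult_mat[of "transpose_mat B" m k U r V q] B U D(1) by simp
  qed
  have fac: "\<exists>P\<in>psd_mats q. X = (U * V) * P * transpose_mat (U * V)"
    if X: "X \<in> feasible_set k As b B" for X
  proof -
    obtain P where P: "P \<in> psd_mats r" "X = U * P * transpose_mat U" using facU[OF X] by blast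
    have Pc: "P \<in> carrier_mat r r" using P(1) by (auto simp: psd_mats_def sym_mats_def)
    have "Z * P = 0\<^sub>m r r"
    proof (cases "j = 1")
      case True
      then have "U = 1\<^sub>m k" and r: "r = k" and ZB: "Z = B * transpose_mat B"
        using j ch by (auto simp: r_def fra_choice_def)
      then have "X = P" using P(2) Pc by simp
      then have "transpose_mat B * P = 0\<^sub>m m k" using X B by (simp add: feasible_set_def)
      then show ?thesis
        using ZB r B Pc assoc_mult_mat[of B k m "transpose_mat B" k P k] by simp
    next
      case False
      then obtain y where y: "y \<in> carrier_vec (length Cs)" "b \<bullet> y = 0" "Z = mat_lincomb r Cs y"
        using ch by (auto simp: fra_choice_def aux_solutions_def r_def)
      have Csc: "set Cs \<subseteq> carrier_mat r r" using Cs As U by auto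
      have "lin_op Cs P = b"
        using X P(2) lin_op_congruence[OF As U Pc] Cs by (simp add: feasible_set_def)
      then have "mat_inner Z P = 0"
        using mat_inner_mat_lincomb[OF Csc Pc y(1)] y by simp
      then show ?thesis using psd_mats_mult_eq_0[OF Z(2) P(1)] by simp
    qed
    from psd_mats_factor_kernel[OF Z(1) V P(1) this] obtain Q
      where Q: "Q \<in> psd_mats q" "P = V * Q * transpose_mat V" unfolding q_def by blast
    have Qc: "Q \<in> carrier_mat q q" using Q(1) by (auto simp: psd_mats_def sym_mats_def)
    have "X = (U * V) * Q * transpose_mat (U * V)"
      unfolding P(2) Q(2) transpose_mult[OF U D(1)]
      using carrier_matD[OF Qc] carrier_matD[OF U] carrier_matD[OF D(1)]
      by (simp add: assoc_mult_mat_dim del: assoc_mult_mat)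
    then show ?thesis using Q(1) by blast
  qed
  have dim: "dim_col (U * V) = q" by (simp add: q_def)
  show ?thesis
    unfolding s' fra_invariant_def prod.case dim maps
    using UV inj j(1) BUV fac by simp
qed

lemma fra_invariant_reachable:
  assumes "fra_reachable k As b B s" and "set As \<subseteq> carrier_mat k k" "B \<in> carrier_mat k m"
  shows "fra_invariant k As b B s"
  using assms(1) unfolding fra_reachable_def
proof (induction rule: rtranclp_induct)
  case base
  show ?case by (rule fra_invariant_init[OF assms(2)])
next
  case (step s s')
  show ?case by (rule fra_invariant_step[OF step.IH step.hyps(2) assms(2,3)])
qed

lemma fra_step_dim_less:
  assumes "fra_step b B s s'" "fst s > 1"
  shows "dim_col (snd (snd s')) < dim_col (snd (snd s))"
proof -
  obtain j Cs U where s: "s = (j, Cs, U)" by (cases s)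
  obtain Z V where Z: "Z \<in> aux_solutions (dim_col U) Cs b" "Z \<noteq> 0\<^sub>m (dim_col U) (dim_col U)"
    and V: "null_space_basis (dim_col U) Z V" and U': "snd (snd s') = U * V"
    using assms by (auto simp: s fra_step_def fra_choice_def)
  have "Z \<in> carrier_mat (dim_col U) (dim_col U)"
    using Z(1) by (auto simp: aux_solutions_def psd_mats_def sym_mats_def)
  from dim_col_null_space_basis_less[OF this V Z(2)] show ?thesis by (simp add: s U')
qed

lemma fra_terminates:
  "\<nexists>\<sigma> :: nat \<Rightarrow> fra_state. \<sigma> 0 = fra_init k As \<and> (\<forall>i. fra_step b B (\<sigma> i) (\<sigma> (Suc i)))"
proof
  assume "\<exists>\<sigma> :: nat \<Rightarrow> fra_state. \<sigma> 0 = fra_init k As \<and> (\<forall>i. fra_step b B (\<sigma> i) (\<sigma> (Suc i)))"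
  then obtain \<sigma> :: "nat \<Rightarrow> fra_state" where init: "\<sigma> 0 = fra_init k As"
    and step: "\<And>i. fra_step b B (\<sigma> i) (\<sigma> (Suc i))" by blast
  have fst: "fst (\<sigma> i) = Suc i" for i
  proof (induction i)
    case 0
    then show ?case by (simp add: init fra_init_def)
  next
    case (Suc i)
    then show ?case using step[of i] by (auto simp: fra_step_def split: prod.splits)
  qed
  define d where "d i = dim_col (snd (snd (\<sigma> (Suc i))))" for i
  have "d (Suc i) < d i" for i
    using fra_step_dim_less[OF step[of "Suc i"]] fst[of "Suc i"] by (simp add: d_def)
  then show False using wf_less_than unfolding wf_iff_no_infinite_down_chain by auto
qed

lemma fra_progress:
  assumes inv: "fra_invariant k As b B s" and B: "B \<in> carrier_mat k m" and nexit: "\<not> fra_exit b s"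
  shows "\<exists>s'. fra_step b B s s'"
proof -
  obtain j Cs U where s: "s = (j, Cs, U)" by (cases s)
  have "\<exists>Z. fra_choice b B (j, Cs, U) Z"
  proof (cases "j = 1")
    case True
    then show ?thesis by (simp add: fra_choice_def)
  next
    case False
    moreover have "1 \<le> j" using inv by (simp add: s fra_invariant_def)
    ultimately show ?thesis using nexit by (auto simp: s fra_exit_def fra_choice_def)
  qed
  then obtain Z where Z: "fra_choice b B (j, Cs, U) Z" by blast
  from ex_null_space_basis[OF fra_invariant_choice(1)[OF inv[unfolded s] B Z]] Z
  show ?thesis unfolding s fra_step_def by blast
qed

lemma fra_exit_returns:
  assumes inv: "fra_invariant k As b B s" and ex: "fra_exit b s"
    and As: "set As \<subseteq> sym_mats k" and b: "b \<in> carrier_vec (length As)"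
    and feas: "feasible_set k As b B \<noteq> {}"
  shows "\<exists>X. fra_returns b s X"
proof -
  obtain j Cs U where s: "s = (j, Cs, U)" by (cases s)
  define r where "r = dim_col U"
  have Asc: "set As \<subseteq> carrier_mat k k" using As by (auto simp: sym_mats_def)
  from inv[unfolded s fra_invariant_def] have U: "U \<in> carrier_mat k r"
    and Cs: "Cs = map (\<lambda>M. transpose_mat U * M * U) As"
    and fac: "\<And>X. X \<in> feasible_set k As b B \<Longrightarrow> \<exists>P\<in>psd_mats r. X = U * P * transpose_mat U"
    by (auto simp: r_def)
  obtain X P where X: "X \<in> feasible_set k As b B" and P: "P \<in> psd_mats r" "X = U * P * transpose_mat U"
    using feas fac by blast
  have "P \<in> carrier_mat r r" using P(1) by (auto simp: psd_mats_def sym_mats_def)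
  then have "lin_op Cs P = b"
    using lin_op_congruence[OF Asc U] X P(2) Cs by (simp add: feasible_set_def)
  moreover have "set Cs \<subseteq> sym_mats r" using Cs As sym_mats_congruence[OF _ U] by auto
  moreover have "b \<in> carrier_vec (length Cs)" using b Cs by simp
  ultimately have "\<exists>P\<in>pd_mats r. lin_op Cs P = b"
    using ex P(1) by (intro theorem_of_alternative[where X = P]) (auto simp: s fra_exit_def r_def)
  then show ?thesis using ex unfolding s fra_returns_def r_def by blast
qed

lemma pd_mats_inverse:
  assumes "P \<in> pd_mats n"
  shows "\<exists>H\<in>carrier_mat n n. P * H = 1\<^sub>m n"
proof -
  have P: "P \<in> carrier_mat n n" using assms by (auto simp: pd_mats_def sym_mats_def)
  have "x = 0\<^sub>v n" if "x \<in> carrier_vec n" "P *\<^sub>v x = 0\<^sub>v n" for x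
    using assms that by (force simp: pd_mats_def)
  from ex_left_inverse[OF P this] obtain H where H: "H \<in> carrier_mat n n" "H * P = 1\<^sub>m n" by blast
  then show ?thesis using mat_mult_left_right_inverse[OF H(1) P H(2)] by blast
qed

lemma fra_returns_max_rank:
  assumes inv: "fra_invariant k As b B s" and ret: "fra_returns b s X"
    and As: "set As \<subseteq> carrier_mat k k" and B: "B \<in> carrier_mat k m"
  shows "max_rank_solution k As b B X"
proof -
  obtain j Cs U where s: "s = (j, Cs, U)" by (cases s)
  define r where "r = dim_col U"
  from ret[unfolded s fra_returns_def] obtain P where j: "j > 1" and P: "P \<in> pd_mats r"
    and opP: "lin_op Cs P = b" and X: "X = U * P * transpose_mat U"
    by (auto simp: r_def fra_exit_def)
  from inv[unfolded s fra_invariant_def] j B have U: "U \<in> carrier_mat k r"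
    and Uinj: "\<And>x. x \<in> carrier_vec r \<Longrightarrow> U *\<^sub>v x = 0\<^sub>v k \<Longrightarrow> x = 0\<^sub>v r"
    and Cs: "Cs = map (\<lambda>M. transpose_mat U * M * U) As"
    and BU: "transpose_mat B * U = 0\<^sub>m m r"
    and fac: "\<And>X. X \<in> feasible_set k As b B \<Longrightarrow> \<exists>P\<in>psd_mats r. X = U * P * transpose_mat U"
    by (auto simp: r_def)
  have Pc: "P \<in> carrier_mat r r" using P by (auto simp: pd_mats_def sym_mats_def)
  have Ut: "transpose_mat U \<in> carrier_mat r k" using U by simp
  have "P \<in> psd_mats r"
  proof -
    have "0 \<le> v \<bullet> (P *\<^sub>v v)" if "v \<in> carrier_vec r" for v
      using P that Pc by (cases "v = 0\<^sub>v r") (auto simp: pd_mats_def less_imp_le)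
    then show ?thesis using P by (auto simp: pd_mats_def psd_mats_def)
  qed
  from psd_mats_congruence[OF this U] have "X \<in> psd_mats k" by (simp add: X)
  moreover have "lin_op As X = b" using opP lin_op_congruence[OF As U Pc] by (simp add: Cs X)
  moreover have "transpose_mat B * X = 0\<^sub>m m k"
  proof -
    have UP: "P * transpose_mat U \<in> carrier_mat r k" using Pc Ut by simp
    have "transpose_mat B * X = transpose_mat B * U * (P * transpose_mat U)"
      using assoc_mult_mat[of "transpose_mat B" m k U r, OF _ U UP] B
        assoc_mult_mat[OF U Pc Ut] by (simp add: X)
    also have "\<dots> = 0\<^sub>m m k" unfolding BU using UP by (rule left_mult_zero_mat)
    finally show ?thesis .
  qed
  ultimately have feasX: "X \<in> feasible_set k As b B" using B by (simp add: feasible_set_def)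
  have "vec_space.rank k Y \<le> vec_space.rank k X" if Y: "Y \<in> feasible_set k As b B" for Y
  proof -
    obtain Q where Q: "Q \<in> psd_mats r" "Y = U * Q * transpose_mat U" using fac[OF Y] by blast
    have Qc: "Q \<in> carrier_mat r r" using Q(1) by (auto simp: psd_mats_def sym_mats_def)
    obtain L where L: "L \<in> carrier_mat r k" "L * U = 1\<^sub>m r"
      using ex_left_inverse[OF U Uinj] by blast
    have UL: "transpose_mat U * transpose_mat L = 1\<^sub>m r"
      using transpose_mult[OF L(1) U] L(2) by simp
    obtain H where H: "H \<in> carrier_mat r r" "P * H = 1\<^sub>m r" using pd_mats_inverse[OF P] by blast
    define R where "R = Q * transpose_mat U"
    have R: "R \<in> carrier_mat r k" using Qc Ut by (simp add: R_def)
    have HR: "H * R \<in> carrier_mat r k" using H R by simp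
    have Lt: "transpose_mat L \<in> carrier_mat k r" using L by simp
    have "transpose_mat U * (transpose_mat L * (H * R)) = H * R"
      using assoc_mult_mat[OF Ut Lt HR] UL left_mult_one_mat[OF HR] by simp
    then have "P * transpose_mat U * (transpose_mat L * (H * R)) = P * (H * R)"
      using assoc_mult_mat[OF Pc Ut, of "transpose_mat L * (H * R)" k] Lt HR by simp
    also have "\<dots> = R" using assoc_mult_mat[OF Pc H(1) R] H(2) R by simp
    finally have PR: "P * transpose_mat U * (transpose_mat L * (H * R)) = R" .
    have LHR: "transpose_mat L * (H * R) \<in> carrier_mat k k" using Lt HR by simp
    have "X * (transpose_mat L * (H * R)) = U * (P * transpose_mat U * (transpose_mat L * (H * R)))"
      unfolding X assoc_mult_mat[OF U Pc Ut] by (rule assoc_mult_mat[OF U _ LHR]) (use Pc Ut in simp)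
    also have "\<dots> = Y" unfolding PR unfolding Q(2) R_def using assoc_mult_mat[OF U Qc Ut] by simp
    finally have "Y = X * (transpose_mat L * (H * R))" by simp
    moreover have "X \<in> carrier_mat k k" using U Pc by (simp add: X)
    ultimately show ?thesis using rank_mult_le LHR by metis
  qed
  then show ?thesis using feasX by (simp add: max_rank_solution_def)
qed

theorem theorem4p3:
  fixes k l m :: nat and As :: "real mat list" and b :: "real vec" and B :: "real mat"
  assumes "length As = l"
    and "set As \<subseteq> sym_mats k"
    and "b \<in> carrier_vec l"
    and "B \<in> carrier_mat k m"
  shows "(\<nexists>\<sigma> :: nat \<Rightarrow> fra_state. \<sigma> 0 = fra_init k As \<and> (\<forall>i. fra_step b B (\<sigma> i) (\<sigma> (Suc i))))
    \<and> (\<forall>s. fra_reachable k As b B s \<longrightarrow> fra_exit b s \<or> (\<exists>s'. fra_step b B s s'))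
    \<and> (feasible_set k As b B \<noteq> {} \<longrightarrow>
         (\<forall>s. fra_reachable k As b B s \<and> fra_exit b s \<longrightarrow> (\<exists>X. fra_returns b s X)))
    \<and> (\<forall>s X. fra_reachable k As b B s \<and> fra_returns b s X \<longrightarrow> max_rank_solution k As b B X)"
proof -
  have As: "set As \<subseteq> carrier_mat k k" using assms(2) by (auto simp: sym_mats_def)
  have b: "b \<in> carrier_vec (length As)" using assms(1,3) by simp
  note inv = fra_invariant_reachable[OF _ As assms(4)]
  show ?thesis
  proof (intro conjI allI impI)
    show "\<nexists>\<sigma> :: nat \<Rightarrow> fra_state. \<sigma> 0 = fra_init k As \<and> (\<forall>i. fra_step b B (\<sigma> i) (\<sigma> (Suc i)))"
      by (rule fra_terminates)
    show "fra_exit b s \<or> (\<exists>s'. fra_step b B s s')" if "fra_reachable k As b B s" for s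
      using fra_progress[OF inv[OF that] assms(4)] by blast
    show "\<exists>X. fra_returns b s X"
      if "feasible_set k As b B \<noteq> {}" "fra_reachable k As b B s \<and> fra_exit b s" for s
      using that fra_exit_returns[OF inv _ assms(2) b] by blast
    show "max_rank_solution k As b B X" if "fra_reachable k As b B s \<and> fra_returns b s X" for s X
      using that fra_returns_max_rank[OF inv _ As assms(4)] by blast
  qed
qed

end
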